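(* Assume $\Gamma_R=\varnothing$ and let $u$ be the exact solution, with the usual continuity of $u$ and of its normal flux across any material interfaces. Then for every broken Trefftz field $v_h(c,Z)$, $$\mathcal J(c,Z)=\mathcal G_h\big(u-v_h(c,Z),\,u-v_h(c,Z)\big)=\|u-v_h(c,Z)\|_{\mathcal G,h}^2 .$$ The identity holds independently of how the coefficient vector $c$ is obtained; the same positive weights $\alpha$ and $\beta$ are used in $\mathcal J$ and $\mathcal G_h$.
   Context: **Problem.** $\Omega\subset\mathbb R^2$ is a bounded Lipschitz domain with Dirichlet data $g$ on the whole boundary $\partial\Omega=\Gamma_D$ (all-Dirichlet case, $\Gamma_R=\varnothing$). $\mathcal T_h$ is a mesh of $\Omega$, with interior edges $\mathcal E_h^{\rm I}$ and elementwise gradient $\nabla_h$. The wavenumber is either a constant $\kappa>0$ or piecewise constant, equal to $\kappa_K>0$ on each element $K$. The exact solution $u$ satisfies $\Delta u+\kappa^2u=0$ in $\Omega$ (in the piecewise-constant case, $\Delta u+\kappa_K^2u=0$ in each $K$, with $u$ and its normal flux continuous across material interfaces), and $u=g$ on $\Gamma_D$. The traces of $u$ and $\nabla u$ on edges are taken to be such that the edge integrals below make sense. **Jumps.** On an interior edge $e=\partial K^+\cap\partial K^-$ with outward normals $n^\pm$: $[\![v]\!]=v^+n^++v^-n^-$ for scalar traces (vector valued) and $[\![\tau]\!]_n=\tau^+\cdot n^++\tau^-\cdot n^-$ for vector traces (scalar valued). **Edge scale.** $\xi_e=\kappa$ for constant wavenumber; $\xi_e=\frac12(\kappa_{K^+}+\kappa_{K^-})$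 for piecewise-constant wavenumber. On $\Gamma_D$, $\kappa$ is the (local) wavenumber. $\alpha,\beta>0$ are fixed. **Broken Trefftz fields.** For an element $K$ with reference point $x_K$ and $z\in\mathbb C$, $q_K(z)=\kappa_K(\cos z,\sin z)$ and $\phi_{K,z}(x)=\exp(iq_K(z)\cdot(x-x_K))$ for $x\in K$ (bilinear dot product), extended by zero to the other elements. For a collection $Z$ of finitely many complex angles $z_{K,1},\dots,z_{K,r_K}$ on each element, list all the functions $\phi_{K,z_{K,j}}$ as $\varphi_1(Z),\dots,\varphi_{N_h}(Z)$; for $c\in\mathbb C^{N_h}$ put $v_h(c,Z)=\sum_jc_j\varphi_j(Z)$. **Graph form and residual (for $\Gamma_R=\varnothing$).** $$\mathcal G_h(w,v)=\sum_{e\in\mathcal E_h^{\rm I}}\Big[\alpha\xi_e\int_e[\![w]\!]\cdot\overline{[\![v]\!]}\,ds+\frac{\beta}{\xi_e}\int_e[\![\nabla_hw]\!]_n\,\overline{[\![\nabla_hv]\!]_n}\,ds\Big]+\alpha\kappa\int_{\Gamma_D}w\overline v\,ds,$$ $\|v\|_{\mathcal G,h}=\mathcal G_h(v,v)^{1/2}$, and $$\mathcal J(c,Z)=\sum_{e\in\mathcal E_h^{\rm I}}\int_e\Big[\alpha\xi_e\,|[\![v_h(c,Z)]\!]|^2+\frac{\beta}{\xi_e}\,|[\![\nabla_hv_h(c,Z)]\!]_n|^2\Big]ds+\alpha\kappa\int_{\Gamma_D}|v_h(c,Z)-g|^2\,ds.$$ *)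

theory Defs
  imports "HOL-Analysis.Analysis"
begin

subsection \<open>Arc length\<close>

text \<open>One-dimensional Hausdorff measure, which is arc length on rectifiable curves.  It is completed,
  so that functions determined only almost everywhere, such as outward normals and traces, can be
  integrated.\<close>

definition hausdorff_content :: "real \<Rightarrow> 'a::metric_space set \<Rightarrow> ennreal" where
  "hausdorff_content \<delta> A =
     (INF U\<in>{U :: nat \<Rightarrow> 'a set. A \<subseteq> (\<Union>n. U n) \<and> (\<forall>n. bounded (U n) \<and> diameter (U n) \<le> \<delta>)}.
        \<Sum>n. ennreal (diameter (U n)))"

definition hausdorff1 :: "'a::metric_space set \<Rightarrow> ennreal" where
  "hausdorff1 A = (SUP \<delta>\<in>{0<..}. hausdorff_content \<delta> A)"

lemma hausdorff_content_le:
  "\<lbrakk>A \<subseteq> (\<Union>n. U n); \<And>n. bounded (U n); \<And>n. diameter (U n) \<le> \<delta>\<rbrakk>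
    \<Longrightarrow> hausdorff_content \<delta> A \<le> (\<Sum>n. ennreal (diameter (U n)))"
  unfolding hausdorff_content_def by (intro INF_lower) auto

lemma hausdorff_content_mono:
  "A \<subseteq> B \<Longrightarrow> hausdorff_content \<delta> A \<le> hausdorff_content \<delta> B"
  unfolding hausdorff_content_def by (intro INF_superset_mono) auto

lemma hausdorff_content_antimono:
  "\<delta> \<le> \<epsilon> \<Longrightarrow> hausdorff_content \<epsilon> A \<le> hausdorff_content \<delta> A"
  unfolding hausdorff_content_def by (intro INF_superset_mono) (auto intro: order_trans)

lemma hausdorff_content_le_hausdorff1: "0 < \<delta> \<Longrightarrow> hausdorff_content \<delta> A \<le> hausdorff1 A"
  unfolding hausdorff1_def by (intro SUP_upper) auto

lemma hausdorff1_mono: "A \<subseteq> B \<Longrightarrow> hausdorff1 A \<le> hausdorff1 B"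
  unfolding hausdorff1_def by (intro SUP_mono) (auto intro: hausdorff_content_mono)

lemma hausdorff1_empty [simp]: "hausdorff1 ({} :: 'a::metric_space set) = 0"
proof -
  have "hausdorff_content \<delta> ({} :: 'a set) \<le> 0" if "\<delta> > 0" for \<delta> :: real
    using hausdorff_content_le[of "{}" "\<lambda>_. {} :: 'a set" \<delta>] that by simp
  then show ?thesis
    unfolding hausdorff1_def by (intro antisym SUP_least) (simp_all del: le_zero_eq)
qed

lemma hausdorff_content_UN_le:
  "hausdorff_content \<delta> (\<Union>i::nat. A i) \<le> (\<Sum>i. hausdorff_content \<delta> (A i))"
proof (rule ennreal_le_epsilon)
  fix e :: real
  assume "0 < e" and fin: "(\<Sum>n. hausdorff_content \<delta> (A n)) < top"
  then have *: "\<And>n. hausdorff_content \<delta> (A n) < hausdorff_content \<delta> (A n) + e * (1/2)^Suc n"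
    by (auto simp add: less_top dest!: ennreal_suminf_lessD)
  have "\<exists>U. A n \<subseteq> (\<Union>i. U i) \<and> (\<forall>i. bounded (U i) \<and> diameter (U i) \<le> \<delta>) \<and>
          (\<Sum>i. ennreal (diameter (U i))) \<le> hausdorff_content \<delta> (A n) + e * (1/2)^Suc n" for n
    using *[of n] unfolding hausdorff_content_def[of \<delta> "A n"] INF_less_iff
    by (auto intro: less_imp_le)
  then obtain B where B: "\<And>n. A n \<subseteq> (\<Union>i. B n i)" "\<And>n i. bounded (B n i)"
      "\<And>n i. diameter (B n i) \<le> \<delta>"
      "\<And>n. (\<Sum>i. ennreal (diameter (B n i))) \<le> hausdorff_content \<delta> (A n) + e * (1/2)^Suc n"
    by metis
  define C where "C = case_prod B o prod_decode"
  have A_C: "(\<Union>i. A i) \<subseteq> (\<Union>i. C i)"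
    using B(1) by (auto simp add: C_def subset_eq) (metis prod.case prod_encode_inverse)
  have "hausdorff_content \<delta> (\<Union>i. A i) \<le> (\<Sum>i. ennreal (diameter (C i)))"
    using B(2,3) by (intro hausdorff_content_le A_C) (auto simp: C_def split_def)
  also have "\<dots> = (\<Sum>n. \<Sum>i. ennreal (diameter (B n i)))"
    unfolding C_def comp_def split_def
    by (rule suminf_ennreal_2dimen) simp
  also have "\<dots> \<le> (\<Sum>n. hausdorff_content \<delta> (A n) + e * (1/2) ^ Suc n)"
    by (intro suminf_le allI B) auto
  also have "... = (\<Sum>n. hausdorff_content \<delta> (A n)) + (\<Sum>n. ennreal e * ennreal ((1/2) ^ Suc n))"
    using \<open>0 < e\<close> by (subst suminf_add[symmetric])
                     (auto simp del: ennreal_suminf_cmult simp add: ennreal_mult[symmetric])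
  also have "\<dots> = (\<Sum>n. hausdorff_content \<delta> (A n)) + e"
    unfolding ennreal_suminf_cmult
    by (subst suminf_ennreal_eq[OF zero_le_power power_half_series]) auto
  finally show "hausdorff_content \<delta> (\<Union>i. A i) \<le> (\<Sum>n. hausdorff_content \<delta> (A n)) + e" .
qed

lemma hausdorff1_UN_le: "hausdorff1 (\<Union>i::nat. A i) \<le> (\<Sum>i. hausdorff1 (A i))"
  unfolding hausdorff1_def[of "\<Union>i. A i"]
proof (intro SUP_least)
  fix \<delta> :: real assume \<delta>: "\<delta> \<in> {0<..}"
  have "hausdorff_content \<delta> (\<Union>i. A i) \<le> (\<Sum>i. hausdorff_content \<delta> (A i))"
    by (rule hausdorff_content_UN_le)
  also have "\<dots> \<le> (\<Sum>i. hausdorff1 (A i))"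
    using \<delta> by (intro suminf_le hausdorff_content_le_hausdorff1) auto
  finally show "hausdorff_content \<delta> (\<Union>i. A i) \<le> (\<Sum>i. hausdorff1 (A i))" .
qed

lemma hausdorff1_Un_le: "hausdorff1 (A \<union> B) \<le> hausdorff1 A + hausdorff1 B"
proof -
  define F where "F = (\<lambda>i::nat. if i = 0 then A else if i = 1 then B else {})"
  have "A \<union> B = (\<Union>i. F i)" unfolding F_def by (auto split: if_splits)
  then have "hausdorff1 (A \<union> B) \<le> (\<Sum>i. hausdorff1 (F i))" using hausdorff1_UN_le[of F] by simp
  also have "\<dots> = (\<Sum>i\<in>{0,1}. hausdorff1 (F i))" by (rule suminf_finite) (auto simp: F_def)
  also have "\<dots> = hausdorff1 A + hausdorff1 B" by (simp add: F_def)
  finally show ?thesis .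
qed

lemma hausdorff1_separated:
  fixes A B :: "'a::metric_space set"
  assumes s: "s > 0" and sep: "\<And>x y. x \<in> A \<Longrightarrow> y \<in> B \<Longrightarrow> s \<le> dist x y"
  shows "hausdorff1 A + hausdorff1 B \<le> hausdorff1 (A \<union> B)"
proof -
  have small: "hausdorff_content \<delta> A + hausdorff_content \<delta> B \<le> hausdorff1 (A \<union> B)"
    if \<delta>: "0 < \<delta>" "\<delta> < s" for \<delta>
  proof -
    have "hausdorff_content \<delta> A + hausdorff_content \<delta> B \<le> hausdorff_content \<delta> (A \<union> B)"
      unfolding hausdorff_content_def[of \<delta> "A \<union> B"]
    proof (intro INF_greatest)
      fix U :: "nat \<Rightarrow> 'a set"
      assume "U \<in> {U. A \<union> B \<subseteq> (\<Union>n. U n) \<and> (\<forall>n. bounded (U n) \<and> diameter (U n) \<le> \<delta>)}"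
      then have U: "A \<subseteq> (\<Union>n. U n)" "B \<subseteq> (\<Union>n. U n)" "\<And>n. bounded (U n)" "\<And>n. diameter (U n) \<le> \<delta>"
        by auto
      define V where "V n = (if U n \<inter> A = {} then {} else U n)" for n
      define W where "W n = (if U n \<inter> B = {} then {} else U n)" for n
      have disj: "U n \<inter> A = {} \<or> U n \<inter> B = {}" for n
      proof (rule ccontr)
        assume "\<not> ?thesis"
        then obtain x y where "x \<in> U n" "x \<in> A" "y \<in> U n" "y \<in> B" by auto
        then have "s \<le> dist x y" "dist x y \<le> diameter (U n)"
          using sep diameter_bounded_bound[OF U(3)] by auto
        with U(4)[of n] \<delta> show False by simp
      qed
      have "hausdorff_content \<delta> A \<le> (\<Sum>n. ennreal (diameter (V n)))"
        using U \<delta> by (intro hausdorff_content_le) (fastforce simp: V_def)+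
      moreover have "hausdorff_content \<delta> B \<le> (\<Sum>n. ennreal (diameter (W n)))"
        using U \<delta> by (intro hausdorff_content_le) (fastforce simp: W_def)+
      ultimately have "hausdorff_content \<delta> A + hausdorff_content \<delta> B \<le>
          (\<Sum>n. ennreal (diameter (V n))) + (\<Sum>n. ennreal (diameter (W n)))"
        by (rule add_mono)
      also have "\<dots> = (\<Sum>n. ennreal (diameter (V n)) + ennreal (diameter (W n)))"
        by (simp add: suminf_add)
      also have "\<dots> \<le> (\<Sum>n. ennreal (diameter (U n)))"
        using disj by (intro suminf_le) (auto simp: V_def W_def)
      finally show "hausdorff_content \<delta> A + hausdorff_content \<delta> B \<le> (\<Sum>n. ennreal (diameter (U n)))" .
    qed
    also have "\<dots> \<le> hausdorff1 (A \<union> B)" using \<delta> by (intro hausdorff_content_le_hausdorff1)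
    finally show ?thesis .
  qed
  have both: "hausdorff_content \<delta> A + hausdorff_content \<epsilon> B \<le> hausdorff1 (A \<union> B)"
    if "0 < \<delta>" "0 < \<epsilon>" for \<delta> \<epsilon>
  proof -
    define \<eta> where "\<eta> = min (min \<delta> \<epsilon>) (s/2)"
    have \<eta>: "0 < \<eta>" "\<eta> < s" "\<eta> \<le> \<delta>" "\<eta> \<le> \<epsilon>" using that s by (auto simp: \<eta>_def)
    have "hausdorff_content \<delta> A + hausdorff_content \<epsilon> B \<le> hausdorff_content \<eta> A + hausdorff_content \<eta> B"
      using \<eta> by (intro add_mono hausdorff_content_antimono)
    also have "\<dots> \<le> hausdorff1 (A \<union> B)" using small \<eta> by blast
    finally show ?thesis .
  qed
  have ne: "{0::real<..} \<noteq> {}" using gt_ex by auto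
  have "hausdorff1 A + hausdorff_content \<epsilon> B \<le> hausdorff1 (A \<union> B)" if "0 < \<epsilon>" for \<epsilon>
  proof -
    have "hausdorff1 A + hausdorff_content \<epsilon> B
        = (SUP \<delta>\<in>{0<..}. hausdorff_content \<delta> A + hausdorff_content \<epsilon> B)"
      unfolding hausdorff1_def using ne by (simp add: ennreal_SUP_add_left)
    also have "\<dots> \<le> hausdorff1 (A \<union> B)" using both that by (intro SUP_least) auto
    finally show ?thesis .
  qed
  then have "(SUP \<epsilon>\<in>{0<..}. hausdorff1 A + hausdorff_content \<epsilon> B) \<le> hausdorff1 (A \<union> B)"
    by (intro SUP_least) auto
  moreover have "hausdorff1 A + hausdorff1 B = (SUP \<epsilon>\<in>{0<..}. hausdorff1 A + hausdorff_content \<epsilon> B)"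
    unfolding hausdorff1_def[of B] using ne by (simp add: ennreal_SUP_add_right)
  ultimately show ?thesis by simp
qed

lemma hausdorff1_closed_caratheodory:
  fixes A C :: "'a::metric_space set"
  assumes "closed C"
  shows "hausdorff1 (A \<inter> C) + hausdorff1 (A - C) \<le> hausdorff1 A"
proof (cases "hausdorff1 A = top \<or> C = {}")
  case True
  then show ?thesis by auto
next
  case False
  then have fin: "hausdorff1 A \<noteq> top" and "C \<noteq> {}" by auto
  define f where "f x = infdist x C" for x :: 'a
  define F where "F n = {x \<in> A. 1 / real (Suc n) \<le> f x}" for n
  define D where "D n = {x \<in> A. 1 / real (n + 2) \<le> f x \<and> f x < 1 / real (Suc n)}" for n
  have f_lip: "f x \<le> f y + dist x y" for x y
    unfolding f_def by (rule infdist_triangle)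
  have f0: "f x = 0" if "x \<in> C" for x using that by (simp add: f_def)
  have fpos: "f x > 0" if "x \<notin> C" for x
    using that assms \<open>C \<noteq> {}\<close> unfolding f_def by (simp add: in_closed_iff_infdist_zero infdist_pos_not_in_closed)
  have split: "A - C \<subseteq> F n \<union> (\<Union>k. D (k + n))" for n
  proof
    fix x assume x: "x \<in> A - C"
    then have p: "f x > 0" using fpos by auto
    show "x \<in> F n \<union> (\<Union>k. D (k + n))"
    proof (cases "x \<in> F n")
      case False
      then have lt: "f x < 1 / real (Suc n)" using x by (auto simp: F_def)
      obtain m where m: "1 / real (Suc m) \<le> f x"
        using p by (metis inverse_eq_divide less_imp_le reals_Archimedean)
      define j where "j = (LEAST m. 1 / real (Suc m) \<le> f x)"
      have j: "1 / real (Suc j) \<le> f x" unfolding j_def by (rule LeastI[where P="\<lambda>m. 1 / real (Suc m) \<le> f x", OF m])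
      have "\<not> Suc j \<le> Suc n"
      proof
        assume "Suc j \<le> Suc n"
        then have "1 / real (Suc n) \<le> 1 / real (Suc j)" by (intro divide_left_mono) auto
        with j lt show False by simp
      qed
      then obtain k where k: "j = Suc (k + n)" by (metis Suc_le_mono add.commute less_iff_Suc_add not_less)
      have "\<not> 1 / real (Suc (k + n)) \<le> f x"
        using not_less_Least[of "k + n" "\<lambda>m. 1 / real (Suc m) \<le> f x"] k unfolding j_def by auto
      then have "x \<in> D (k + n)" using j k x by (auto simp: D_def add_ac)
      then show ?thesis by auto
    qed auto
  qed
  have CF: "hausdorff1 (A \<inter> C) + hausdorff1 (F n) \<le> hausdorff1 A" for n
  proof -
    have "1 / real (Suc n) \<le> dist x y" if "x \<in> A \<inter> C" "y \<in> F n" for x y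
      using f_lip[of y x] f0[of x] that by (auto simp: F_def dist_commute)
    then have "hausdorff1 (A \<inter> C) + hausdorff1 (F n) \<le> hausdorff1 (A \<inter> C \<union> F n)"
      by (intro hausdorff1_separated[of "1 / real (Suc n)"]) auto
    also have "\<dots> \<le> hausdorff1 A" by (intro hausdorff1_mono) (auto simp: F_def)
    finally show ?thesis .
  qed
  have skip: "(\<Sum>k<m. hausdorff1 (D (2 * k + p))) \<le> hausdorff1 A" for m p
  proof -
    have "(\<Sum>k<m. hausdorff1 (D (2 * k + p))) \<le> hausdorff1 (\<Union>k<m. D (2 * k + p))"
    proof (induction m)
      case (Suc m)
      define s where "s = 1 / real (2 * m + p) - 1 / real (Suc (2 * m + p))"
      have D_sep: "s \<le> dist x y \<and> 0 < s" if "x \<in> D (2 * k + p)" "k < m" "y \<in> D (2 * m + p)" for x y k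
      proof -
        have "1 / real (2 * m + p) \<le> 1 / real (2 * k + p + 2)"
          using that(2) by (intro divide_left_mono) auto
        also have "\<dots> \<le> f x" using that(1) by (auto simp: D_def)
        finally have "1 / real (2 * m + p) \<le> f x" .
        moreover have "f y < 1 / real (Suc (2 * m + p))" using that(3) by (auto simp: D_def)
        moreover have "1 / real (Suc (2 * m + p)) < 1 / real (2 * m + p)"
          using that(2) by (intro divide_strict_left_mono) auto
        ultimately show ?thesis using f_lip[of x y] by (auto simp: s_def)
      qed
      have "hausdorff1 (\<Union>k<m. D (2 * k + p)) + hausdorff1 (D (2 * m + p))
          \<le> hausdorff1 ((\<Union>k<m. D (2 * k + p)) \<union> D (2 * m + p))"
      proof (cases "s > 0")
        case True
        then show ?thesis by (intro hausdorff1_separated[of s]) (use D_sep in auto)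
      next
        case False
        then have "(\<Union>k<m. D (2 * k + p)) = {} \<or> D (2 * m + p) = {}" using D_sep by blast
        then show ?thesis by (elim disjE) simp_all
      qed
      then have "hausdorff1 (\<Union>k<m. D (2 * k + p)) + hausdorff1 (D (2 * m + p))
          \<le> hausdorff1 (\<Union>k<Suc m. D (2 * k + p))"
        by (simp add: lessThan_Suc Un_commute)
      with Suc show ?case by (simp add: order_trans[OF add_right_mono])
    qed simp
    also have "\<dots> \<le> hausdorff1 A" by (intro hausdorff1_mono) (auto simp: D_def)
    finally show ?thesis .
  qed
  define S where "S = (\<Sum>k. hausdorff1 (D k))"
  have part: "(\<Sum>k<2 * m. hausdorff1 (D k)) \<le> hausdorff1 A + hausdorff1 A" for m
  proof -
    have "(\<Sum>k<2 * m. hausdorff1 (D k)) =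
        (\<Sum>k<m. hausdorff1 (D (2 * k + 0))) + (\<Sum>k<m. hausdorff1 (D (2 * k + 1)))"
      by (induction m) (simp_all add: add_ac)
    also have "\<dots> \<le> hausdorff1 A + hausdorff1 A" by (intro add_mono skip)
    finally show ?thesis .
  qed
  have "S \<le> hausdorff1 A + hausdorff1 A"
    unfolding S_def
  proof (rule suminf_le_const[OF summableI])
    fix n
    have "(\<Sum>k<n. hausdorff1 (D k)) \<le> (\<Sum>k<2 * n. hausdorff1 (D k))"
      by (rule sum_mono2) auto
    also note part
    finally show "(\<Sum>k<n. hausdorff1 (D k)) \<le> hausdorff1 A + hausdorff1 A" .
  qed
  then have Sfin: "S \<noteq> top" using fin by (auto simp: top_unique)
  define X where "X = hausdorff1 (A \<inter> C) + hausdorff1 (A - C)"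
  have step: "X + (\<Sum>k<n. hausdorff1 (D k)) \<le> hausdorff1 A + S" for n
  proof -
    have "hausdorff1 (A - C) \<le> hausdorff1 (F n \<union> (\<Union>k. D (k + n)))"
      by (intro hausdorff1_mono split)
    also have "\<dots> \<le> hausdorff1 (F n) + hausdorff1 (\<Union>k. D (k + n))"
      by (rule hausdorff1_Un_le)
    also have "\<dots> \<le> hausdorff1 (F n) + (\<Sum>k. hausdorff1 (D (k + n)))"
      by (intro add_left_mono hausdorff1_UN_le)
    finally have "X + (\<Sum>k<n. hausdorff1 (D k)) \<le>
        hausdorff1 (A \<inter> C) + (hausdorff1 (F n) + (\<Sum>k. hausdorff1 (D (k + n)))) + (\<Sum>k<n. hausdorff1 (D k))"
      unfolding X_def by (intro add_right_mono add_left_mono)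
    also have "\<dots> = (hausdorff1 (A \<inter> C) + hausdorff1 (F n)) + S"
      unfolding S_def suminf_offset[of "\<lambda>k. hausdorff1 (D k)" n, OF summableI] by (simp add: add_ac)
    also have "\<dots> \<le> hausdorff1 A + S" by (intro add_right_mono CF)
    finally show ?thesis .
  qed
  have "(SUP n. X + (\<Sum>k<n. hausdorff1 (D k))) \<le> hausdorff1 A + S"
    by (intro SUP_least step)
  moreover have "(SUP n. X + (\<Sum>k<n. hausdorff1 (D k))) = X + S"
    unfolding S_def suminf_eq_SUP by (simp add: ennreal_SUP_add_right)
  ultimately have "S + X \<le> S + hausdorff1 A" by (simp add: add_ac)
  then show ?thesis
    using Sfin unfolding X_def by (simp add: ennreal_add_left_cancel_le)
qed

lemma measure_space_hausdorff1:
  "measure_space UNIV (sets (borel :: 'a::metric_space measure)) hausdorff1"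
proof -
  have oms: "outer_measure_space (Pow UNIV) (hausdorff1 :: 'a set \<Rightarrow> ennreal)"
    unfolding outer_measure_space_def
    by (auto simp: positive_def increasing_def countably_subadditive_def
             intro: hausdorff1_mono hausdorff1_UN_le)
  interpret P: sigma_algebra "UNIV :: 'a set" "Pow UNIV" by (rule sigma_algebra_Pow)
  have ms: "measure_space UNIV (lambda_system UNIV (Pow UNIV) (hausdorff1 :: 'a set \<Rightarrow> ennreal)) hausdorff1"
    by (rule P.caratheodory_lemma[OF oms])
  have "C \<in> lambda_system UNIV (Pow UNIV) hausdorff1" if "closed C" for C :: "'a set"
    unfolding P.lambda_system_eq
  proof (safe intro!: antisym)
    fix A :: "'a set"
    show "hausdorff1 (A \<inter> C) + hausdorff1 (A - C) \<le> hausdorff1 A"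
      using that by (rule hausdorff1_closed_caratheodory)
    show "hausdorff1 A \<le> hausdorff1 (A \<inter> C) + hausdorff1 (A - C)"
      using hausdorff1_Un_le[of "A \<inter> C" "A - C"] by (simp add: Int_Diff_Un)
  qed auto
  moreover have "sets (borel :: 'a measure) = sigma_sets UNIV (Collect closed)"
    by (simp add: borel_eq_closed)
  ultimately have "sets (borel :: 'a measure) \<subseteq> lambda_system UNIV (Pow UNIV) hausdorff1"
    using sigma_algebra.sigma_sets_subset[of UNIV "lambda_system UNIV (Pow UNIV) hausdorff1" "Collect closed"] ms
    by (auto simp: measure_space_def)
  then show ?thesis
    using measure_down[OF ms] sets.sigma_algebra_axioms[of "borel :: 'a measure"] by simp
qed

definition arc_length :: "'a::metric_space measure" where
  "arc_length = completion (measure_of UNIV (sets borel) hausdorff1)"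

lemma emeasure_arc_length:
  fixes A :: "'a::metric_space set"
  assumes "A \<in> sets borel"
  shows "emeasure arc_length A = hausdorff1 A"
proof -
  define M where "M = measure_of UNIV (sets (borel :: 'a measure)) hausdorff1"
  have sets: "sets M = sets borel"
    unfolding M_def using sets.sigma_sets_eq[of "borel :: 'a measure"] by simp
  have "emeasure M A = hausdorff1 A"
    using measure_space_hausdorff1[where 'a='a] assms sets
    by (intro emeasure_measure_of[OF M_def]) (auto simp: measure_space_def)
  then show ?thesis
    using assms sets by (simp add: arc_length_def M_def[symmetric])
qed


subsection \<open>Domain, mesh and edges\<close>

definition lipschitz_domain :: "(real^2) set \<Rightarrow> bool" where
  "lipschitz_domain S \<longleftrightarrow>
     open S \<and> connected S \<and> S \<noteq> {} \<and> bounded S \<and>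
     (\<forall>x\<in>frontier S. \<exists>\<nu> \<tau> \<phi> L r.
        norm \<nu> = 1 \<and> norm \<tau> = 1 \<and> \<nu> \<bullet> \<tau> = 0 \<and> 0 < r \<and> L-lipschitz_on UNIV (\<phi> :: real \<Rightarrow> real) \<and>
        (\<forall>y\<in>ball x r. y \<in> S \<longleftrightarrow> (y - x) \<bullet> \<nu> < \<phi> ((y - x) \<bullet> \<tau>)))"

text \<open>At most one \<open>n\<close> is an outward unit normal of the open set \<open>S\<close> at a boundary point \<open>x\<close>:
  up to an arbitrarily thin double cone around the tangent, \<open>S\<close> is near \<open>x\<close> the half plane
  \<open>(y - x) \<bullet> n < 0\<close>.\<close>

definition is_outward_normal :: "(real^2) set \<Rightarrow> real^2 \<Rightarrow> real^2 \<Rightarrow> bool" where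
  "is_outward_normal S x n \<longleftrightarrow>
     norm n = 1 \<and>
     (\<forall>\<epsilon>>0. \<exists>\<delta>>0. \<forall>y\<in>ball x \<delta>.
        ((y - x) \<bullet> n < - \<epsilon> * norm (y - x) \<longrightarrow> y \<in> S) \<and>
        ((y - x) \<bullet> n > \<epsilon> * norm (y - x) \<longrightarrow> y \<notin> S))"

definition outward_normal :: "(real^2) set \<Rightarrow> real^2 \<Rightarrow> real^2" where
  "outward_normal S x = (THE n. is_outward_normal S x n)"

text \<open>The elements \<open>K 0, \<dots>, K (N - 1)\<close> are taken as open sets.  The last two conditions on each
  element hold for polygons and, more generally, for all Lipschitz elements (by Rademacher's
  theorem).  Neither conformity (hanging nodes) nor shape regularity is required.\<close>

definition is_mesh :: "(real^2) set \<Rightarrow> nat \<Rightarrow> (nat \<Rightarrow> (real^2) set) \<Rightarrow> bool" where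
  "is_mesh \<Omega> N K \<longleftrightarrow>
     (\<forall>i<N. open (K i) \<and> connected (K i) \<and> K i \<noteq> {} \<and> K i \<subseteq> \<Omega> \<and>
        emeasure arc_length (frontier (K i)) < \<infinity> \<and>
        (AE x in arc_length. x \<in> frontier (K i) \<longrightarrow> (\<exists>n. is_outward_normal (K i) x n))) \<and>
     (\<forall>i<N. \<forall>j<N. i \<noteq> j \<longrightarrow> K i \<inter> K j = {}) \<and>
     closure \<Omega> = (\<Union>i<N. closure (K i))"

definition edge :: "(nat \<Rightarrow> (real^2) set) \<Rightarrow> nat \<Rightarrow> nat \<Rightarrow> (real^2) set" where
  "edge K i j = frontier (K i) \<inter> frontier (K j)"

text \<open>An interior edge is represented by its pair of elements; the smaller index plays the role of
  \<open>K\<^sup>+\<close>, which is immaterial because jumps are symmetric in \<open>K\<^sup>+\<close> and \<open>K\<^sup>-\<close>.  Positive length excludes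
  elements that merely share vertices.\<close>

definition interior_edges :: "nat \<Rightarrow> (nat \<Rightarrow> (real^2) set) \<Rightarrow> (nat \<times> nat) set" where
  "interior_edges N K = {(i, j). i < j \<and> j < N \<and> 0 < emeasure arc_length (edge K i j)}"

definition boundary_edge :: "(real^2) set \<Rightarrow> (nat \<Rightarrow> (real^2) set) \<Rightarrow> nat \<Rightarrow> (real^2) set" where
  "boundary_edge \<Omega> K i = frontier (K i) \<inter> frontier \<Omega>"


subsection \<open>Traces, jumps and differential operators\<close>

text \<open>One-sided traces are limits along the inward normal.\<close>

definition has_side_trace :: "(real^2) set \<Rightarrow> (real^2 \<Rightarrow> 'b::t2_space) \<Rightarrow> real^2 \<Rightarrow> bool" where
  "has_side_trace S w x \<longleftrightarrow> (\<exists>l. ((\<lambda>t. w (x - t *\<^sub>R outward_normal S x)) \<longlongrightarrow> l) (at_right 0))"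

definition side_trace :: "(real^2) set \<Rightarrow> (real^2 \<Rightarrow> 'b::t2_space) \<Rightarrow> real^2 \<Rightarrow> 'b" where
  "side_trace S w x = Lim (at_right 0) (\<lambda>t. w (x - t *\<^sub>R outward_normal S x))"

definition normal_trace :: "(real^2) set \<Rightarrow> (real^2 \<Rightarrow> complex^2) \<Rightarrow> real^2 \<Rightarrow> complex" where
  "normal_trace S \<tau> x = (\<Sum>k\<in>UNIV. side_trace S \<tau> x $ k * of_real (outward_normal S x $ k))"

definition jump :: "(real^2) set \<Rightarrow> (real^2) set \<Rightarrow> (real^2 \<Rightarrow> complex) \<Rightarrow> real^2 \<Rightarrow> complex^2" where
  "jump Kp Km v x =
     (\<chi> k. side_trace Kp v x * of_real (outward_normal Kp x $ k) +
           side_trace Km v x * of_real (outward_normal Km x $ k))"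

definition normal_jump :: "(real^2) set \<Rightarrow> (real^2) set \<Rightarrow> (real^2 \<Rightarrow> complex^2) \<Rightarrow> real^2 \<Rightarrow> complex" where
  "normal_jump Kp Km \<tau> x = normal_trace Kp \<tau> x + normal_trace Km \<tau> x"

text \<open>The gradient is only ever used at interior points of elements (through one-sided traces) or
  where the function is smooth, so it also serves as the elementwise gradient.\<close>

definition grad :: "(real^2 \<Rightarrow> complex) \<Rightarrow> real^2 \<Rightarrow> complex^2" where
  "grad w x = (\<chi> k. frechet_derivative w (at x) (axis k 1))"

definition laplacian :: "(real^2 \<Rightarrow> complex) \<Rightarrow> real^2 \<Rightarrow> complex" where
  "laplacian w x = (\<Sum>k\<in>UNIV. grad (\<lambda>y. grad w y $ k) x $ k)"

definition C2_on :: "(real^2) set \<Rightarrow> (real^2 \<Rightarrow> complex) \<Rightarrow> bool" where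
  "C2_on S w \<longleftrightarrow>
     (\<forall>x\<in>S. w differentiable (at x)) \<and>
     (\<forall>x\<in>S. \<forall>k. (\<lambda>y. grad w y $ k) differentiable (at x)) \<and>
     (\<forall>k. continuous_on S (grad (\<lambda>y. grad w y $ k)))"

definition square_integrable_on :: "(real^2) set \<Rightarrow> (real^2 \<Rightarrow> complex) \<Rightarrow> bool" where
  "square_integrable_on S f \<longleftrightarrow>
     set_borel_measurable arc_length S f \<and> set_integrable arc_length S (\<lambda>x. (norm (f x))\<^sup>2)"


subsection \<open>The exact solution\<close>

text \<open>The material interfaces comprise every interior edge across which the wavenumber changes; others
  may be included, since distinct materials can share a wavenumber.  With no interfaces (constant
  wavenumber) the solution below is a classical solution in all of \<open>\<Omega>\<close>; if all interior edges are
  interfaces, the equation is imposed elementwise only.\<close>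

definition material_interfaces ::
  "nat \<Rightarrow> (nat \<Rightarrow> (real^2) set) \<Rightarrow> (nat \<Rightarrow> real) \<Rightarrow> (nat \<times> nat) set \<Rightarrow> bool" where
  "material_interfaces N K \<kappa> I \<longleftrightarrow>
     I \<subseteq> interior_edges N K \<and> (\<forall>(i, j)\<in>interior_edges N K. \<kappa> i \<noteq> \<kappa> j \<longrightarrow> (i, j) \<in> I)"

definition exact_solution ::
  "(real^2) set \<Rightarrow> nat \<Rightarrow> (nat \<Rightarrow> (real^2) set) \<Rightarrow> (nat \<Rightarrow> real) \<Rightarrow> (nat \<times> nat) set \<Rightarrow>
   (real^2 \<Rightarrow> complex) \<Rightarrow> (real^2 \<Rightarrow> complex) \<Rightarrow> bool" where
  "exact_solution \<Omega> N K \<kappa> I g u \<longleftrightarrow>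
     (let S = \<Omega> - (\<Union>(i, j)\<in>I. edge K i j) in
        C2_on S u \<and>
        (\<forall>i<N. \<forall>x\<in>S \<inter> closure (K i). laplacian u x + of_real ((\<kappa> i)\<^sup>2) * u x = 0)) \<and>
     (\<forall>(i, j)\<in>I. AE x in arc_length. x \<in> edge K i j \<longrightarrow>
        side_trace (K i) u x = side_trace (K j) u x \<and>
        normal_jump (K i) (K j) (grad u) x = 0) \<and>
     (\<forall>i<N. AE x in arc_length. x \<in> boundary_edge \<Omega> K i \<longrightarrow> side_trace (K i) u x = g x)"

definition has_edge_traces ::
  "(real^2) set \<Rightarrow> nat \<Rightarrow> (nat \<Rightarrow> (real^2) set) \<Rightarrow> (real^2 \<Rightarrow> complex) \<Rightarrow> bool" where
  "has_edge_traces \<Omega> N K u \<longleftrightarrow>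
     (\<forall>(i, j)\<in>interior_edges N K. \<forall>k\<in>{i, j}.
        (AE x in arc_length. x \<in> edge K i j \<longrightarrow>
           has_side_trace (K k) u x \<and> has_side_trace (K k) (grad u) x) \<and>
        square_integrable_on (edge K i j) (side_trace (K k) u) \<and>
        square_integrable_on (edge K i j) (normal_trace (K k) (grad u))) \<and>
     (\<forall>i<N.
        (AE x in arc_length. x \<in> boundary_edge \<Omega> K i \<longrightarrow> has_side_trace (K i) u x) \<and>
        square_integrable_on (boundary_edge \<Omega> K i) (side_trace (K i) u))"


subsection \<open>Broken Trefftz fields\<close>

definition wave_vector :: "real \<Rightarrow> complex \<Rightarrow> complex^2" where
  "wave_vector k z = vector [of_real k * cos z, of_real k * sin z]"

definition plane_wave :: "(real^2) set \<Rightarrow> real \<Rightarrow> real^2 \<Rightarrow> complex \<Rightarrow> real^2 \<Rightarrow> complex" where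
  "plane_wave S k x0 z x =
     (if x \<in> S then exp (\<i> * (\<Sum>l\<in>UNIV. wave_vector k z $ l * of_real ((x - x0) $ l))) else 0)"

text \<open>\<open>Z i\<close> lists the angles on element \<open>K i\<close>, and \<open>xr i\<close> is its reference point.  Only the
  first \<open>length (trefftz_basis N K \<kappa> xr Z)\<close> entries of a coefficient vector matter.\<close>

definition trefftz_basis ::
  "nat \<Rightarrow> (nat \<Rightarrow> (real^2) set) \<Rightarrow> (nat \<Rightarrow> real) \<Rightarrow> (nat \<Rightarrow> real^2) \<Rightarrow> (nat \<Rightarrow> complex list) \<Rightarrow>
   (real^2 \<Rightarrow> complex) list" where
  "trefftz_basis N K \<kappa> xr Z =
     concat (map (\<lambda>i. map (plane_wave (K i) (\<kappa> i) (xr i)) (Z i)) [0..<N])"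

definition trefftz_field ::
  "nat \<Rightarrow> (nat \<Rightarrow> (real^2) set) \<Rightarrow> (nat \<Rightarrow> real) \<Rightarrow> (nat \<Rightarrow> real^2) \<Rightarrow> (nat \<Rightarrow> complex) \<Rightarrow>
   (nat \<Rightarrow> complex list) \<Rightarrow> real^2 \<Rightarrow> complex" where
  "trefftz_field N K \<kappa> xr c Z x =
     (\<Sum>m<length (trefftz_basis N K \<kappa> xr Z). c m * (trefftz_basis N K \<kappa> xr Z ! m) x)"


subsection \<open>Graph form and residual\<close>

text \<open>For a constant wavenumber \<open>edge_scale\<close> is that constant.  The integral over the Dirichlet
  boundary \<open>frontier \<Omega>\<close>, weighted by the local wavenumber, is split into the boundary edges of the
  elements.\<close>

definition edge_scale :: "(nat \<Rightarrow> real) \<Rightarrow> nat \<Rightarrow> nat \<Rightarrow> real" where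
  "edge_scale \<kappa> i j = (\<kappa> i + \<kappa> j) / 2"

definition graph_form ::
  "(real^2) set \<Rightarrow> nat \<Rightarrow> (nat \<Rightarrow> (real^2) set) \<Rightarrow> (nat \<Rightarrow> real) \<Rightarrow> real \<Rightarrow> real \<Rightarrow>
   (real^2 \<Rightarrow> complex) \<Rightarrow> (real^2 \<Rightarrow> complex) \<Rightarrow> complex" where
  "graph_form \<Omega> N K \<kappa> \<alpha> \<beta> w v =
     (\<Sum>(i, j)\<in>interior_edges N K.
        of_real (\<alpha> * edge_scale \<kappa> i j) *
          (LINT x:edge K i j|arc_length.
             (\<Sum>k\<in>UNIV. jump (K i) (K j) w x $ k * cnj (jump (K i) (K j) v x $ k))) +
        of_real (\<beta> / edge_scale \<kappa> i j) *
          (LINT x:edge K i j|arc_length.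
             normal_jump (K i) (K j) (grad w) x * cnj (normal_jump (K i) (K j) (grad v) x))) +
     (\<Sum>i<N. of_real (\<alpha> * \<kappa> i) *
        (LINT x:boundary_edge \<Omega> K i|arc_length. side_trace (K i) w x * cnj (side_trace (K i) v x)))"

definition graph_norm ::
  "(real^2) set \<Rightarrow> nat \<Rightarrow> (nat \<Rightarrow> (real^2) set) \<Rightarrow> (nat \<Rightarrow> real) \<Rightarrow> real \<Rightarrow> real \<Rightarrow>
   (real^2 \<Rightarrow> complex) \<Rightarrow> real" where
  "graph_norm \<Omega> N K \<kappa> \<alpha> \<beta> v = sqrt (Re (graph_form \<Omega> N K \<kappa> \<alpha> \<beta> v v))"

definition residual ::
  "(real^2) set \<Rightarrow> nat \<Rightarrow> (nat \<Rightarrow> (real^2) set) \<Rightarrow> (nat \<Rightarrow> real) \<Rightarrow> real \<Rightarrow> real \<Rightarrow>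
   (nat \<Rightarrow> real^2) \<Rightarrow> (real^2 \<Rightarrow> complex) \<Rightarrow> (nat \<Rightarrow> complex) \<Rightarrow> (nat \<Rightarrow> complex list) \<Rightarrow> real" where
  "residual \<Omega> N K \<kappa> \<alpha> \<beta> xr g c Z =
     (let v = trefftz_field N K \<kappa> xr c Z in
       (\<Sum>(i, j)\<in>interior_edges N K.
          (LINT x:edge K i j|arc_length.
             \<alpha> * edge_scale \<kappa> i j * (norm (jump (K i) (K j) v x))\<^sup>2 +
             \<beta> / edge_scale \<kappa> i j * (norm (normal_jump (K i) (K j) (grad v) x))\<^sup>2)) +
       (\<Sum>i<N. \<alpha> * \<kappa> i *
          (LINT x:boundary_edge \<Omega> K i|arc_length. (norm (side_trace (K i) v x - g x))\<^sup>2)))"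

end

theory Submission
  imports Defs
begin

text \<open>
  The exact solution contributes nothing to the integrands of the graph form on the interior
  edges, because its jumps vanish there, and it contributes the Dirichlet data on the boundary.
  Traces are linear, so almost everywhere the jumps of \<open>u - v\<close> are the negatives of the jumps of
  the Trefftz field \<open>v\<close>, and the boundary trace of \<open>u - v\<close> is \<open>g\<close> minus that of \<open>v\<close>.  Taking
  squared moduli turns the graph form of the error into the residual, edge by edge.  Since the
  residual is a nonnegative real, its square root squares back to it, which gives the identity with
  the graph norm.

  Three points carry the work.

  First, why the jumps of \<open>u\<close> vanish (\<open>exact_solution_jumps_vanish\<close>).  On a material interface this
  is part of the notion of solution.  On any other edge \<open>u\<close> should be smooth, but an edge is an
  intersection of two frontiers and might meet another interface or the frontier of the domain.
  Wherever outward normals exist, this is impossible: disjoint sets have opposite normals, so three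
  pairwise disjoint elements cannot share such a point
  (\<open>no_three_disjoint_sets_with_normals\<close>), and two opposite elements fill a neighbourhood up to thin
  cones around the tangent, which leaves no room for the exterior cone of a Lipschitz domain
  (\<open>lipschitz_domain_frontier_no_two_elements\<close>).

  Second, the traces of \<open>v\<close>.  On each element \<open>v\<close> agrees with a finite combination of exponentials
  that is smooth on the whole plane (\<open>trefftz_field_C1_extension\<close>), so its one-sided traces and
  those of its gradient are the values of that extension.

  Third, integrability.  The residual integrates the sum of the two jump terms, the graph form
  integrates them separately, so each must be integrable.  The jump of \<open>v\<close> has the modulus of a
  continuous function, but the jump of its normal derivative involves the outward normal itself,
  which is defined pointwise by a description operator and has to be shown measurable.  This is done
  by recovering its components as directional derivatives of the distance to the element
  (\<open>infdist_directional_derivative\<close>).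
\<close>

section \<open>Outward normals\<close>

text \<open>Along a ray that is not tangent, the quotient of \<open>(y - x) \<bullet> n\<close> and \<open>norm (y - x)\<close> is a fixed
  nonzero number, so half of it serves as the cone aperture.\<close>

lemma is_outward_normal_eventually_in:
  assumes n: "is_outward_normal S x n" and d: "d \<bullet> n < 0"
  shows "\<forall>\<^sub>F t in at_right 0. x + t *\<^sub>R d \<in> S"
proof -
  have d0: "norm d > 0" using d by auto
  define \<epsilon> where "\<epsilon> = - (d \<bullet> n) / (2 * norm d)"
  have "\<epsilon> > 0" unfolding \<epsilon>_def using d d0 by (intro divide_pos_pos) auto
  then obtain \<delta> where \<delta>: "\<delta> > 0"
    "\<And>y. y \<in> ball x \<delta> \<Longrightarrow> (y - x) \<bullet> n < - \<epsilon> * norm (y - x) \<Longrightarrow> y \<in> S"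
    using n unfolding is_outward_normal_def by metis
  have "x + t *\<^sub>R d \<in> S" if t: "t > 0" "t < \<delta> / norm d" for t
  proof (rule \<delta>(2))
    show "x + t *\<^sub>R d \<in> ball x \<delta>"
      using t d0 by (simp add: dist_norm field_simps)
    have "- \<epsilon> * norm (t *\<^sub>R d) = t * (d \<bullet> n) / 2"
      using t d0 by (simp add: \<epsilon>_def)
    then show "(x + t *\<^sub>R d - x) \<bullet> n < - \<epsilon> * norm (x + t *\<^sub>R d - x)"
      using mult_pos_neg[OF t(1) d] by simp
  qed
  then show ?thesis
    using \<delta>(1) d0 by (intro eventually_at_rightI[of 0 "\<delta> / norm d"]) auto
qed

lemma is_outward_normal_eventually_not_in:
  assumes n: "is_outward_normal S x n" and d: "d \<bullet> n > 0"
  shows "\<forall>\<^sub>F t in at_right 0. x + t *\<^sub>R d \<notin> S"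
proof -
  \<comment> \<open>The definition is symmetric under complements when the normal is reversed.\<close>
  have "is_outward_normal (- S) x (- n)"
    using n unfolding is_outward_normal_def by (simp add: minus_less_iff) (metis neg_less_iff_less minus_minus)
  from is_outward_normal_eventually_in[OF this, of d] d show ?thesis by simp
qed

lemma unit_vectors_inner_less_1:
  fixes n m :: "'a::real_inner"
  assumes "norm n = 1" "norm m = 1" "n \<noteq> m"
  shows "n \<bullet> m < 1"
proof -
  have "0 < (norm (n - m))\<^sup>2" using assms by simp
  also have "\<dots> = 2 - 2 * (n \<bullet> m)"
    using assms by (simp add: power2_norm_eq_inner inner_diff inner_commute norm_eq_1)
  finally show ?thesis by simp
qed

text \<open>For two distinct unit normals, the ray in direction \<open>m - n\<close> enters the set according to \<open>n\<close> and
  leaves it according to \<open>m\<close>.\<close>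

lemma is_outward_normal_unique:
  assumes n: "is_outward_normal S x n" and m: "is_outward_normal S x m"
  shows "n = m"
proof (rule ccontr)
  assume "n \<noteq> m"
  then have "n \<bullet> m < 1" and nm: "n \<bullet> n = 1" "m \<bullet> m = 1"
    using unit_vectors_inner_less_1[of n m] n m by (auto simp: is_outward_normal_def norm_eq_1)
  then have "(m - n) \<bullet> n < 0" "(m - n) \<bullet> m > 0"
    by (auto simp: inner_diff inner_commute)
  from is_outward_normal_eventually_in[OF n this(1)] is_outward_normal_eventually_not_in[OF m this(2)]
  have "\<forall>\<^sub>F t in at_right (0::real). False" by eventually_elim simp
  then show False by simp
qed

lemma outward_normal_eq: "is_outward_normal S x n \<Longrightarrow> outward_normal S x = n"
  unfolding outward_normal_def using is_outward_normal_unique by blast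

text \<open>Unless the normals are opposite, the two inward half planes overlap, and the ray in direction
  \<open>- n - m\<close> runs into both sets.\<close>

lemma outward_normals_opposite:
  assumes n: "is_outward_normal S x n" and m: "is_outward_normal T x m" and "S \<inter> T = {}"
  shows "m = - n"
proof (rule ccontr)
  assume "m \<noteq> - n"
  then have "- n \<bullet> m < 1" and nm: "n \<bullet> n = 1" "m \<bullet> m = 1"
    using unit_vectors_inner_less_1[of "- n" m] n m by (auto simp: is_outward_normal_def norm_eq_1)
  then have "(- n - m) \<bullet> n < 0" "(- n - m) \<bullet> m < 0"
    by (auto simp: inner_diff inner_commute)
  from is_outward_normal_eventually_in[OF n this(1)] is_outward_normal_eventually_in[OF m this(2)]
  have "\<forall>\<^sub>F t in at_right (0::real). False"
    by eventually_elim (use \<open>S \<inter> T = {}\<close> in blast)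
  then show False by simp
qed

text \<open>This rules out, up to a null set, points that lie on two different edges.\<close>

lemma no_three_disjoint_sets_with_normals:
  assumes "is_outward_normal R x l" "is_outward_normal S x n" "is_outward_normal T x m"
    and "R \<inter> S = {}" "R \<inter> T = {}" "S \<inter> T = {}"
  shows False
proof -
  have "n = - l" "m = - l" "m = - n"
    using outward_normals_opposite assms by blast+
  then have "l \<bullet> l = - (l \<bullet> l)" by (metis inner_minus_left minus_minus)
  then show False using assms(1) by (simp add: is_outward_normal_def norm_eq_1)
qed

lemma orthonormal_span_real2:
  fixes \<nu> \<tau> n :: "real^2"
  assumes "norm \<nu> = 1" "norm \<tau> = 1" "\<nu> \<bullet> \<tau> = 0" "n \<bullet> \<nu> = 0" "n \<bullet> \<tau> = 0"
  shows "n = 0"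
proof (rule ccontr)
  assume "n \<noteq> 0"
  have "pairwise orthogonal {n, \<nu>, \<tau>}" "0 \<notin> {n, \<nu>, \<tau>}"
    using assms \<open>n \<noteq> 0\<close> by (auto simp: pairwise_def orthogonal_def inner_commute)
  then have "independent {n, \<nu>, \<tau>}" by (rule pairwise_orthogonal_independent)
  then have "card {n, \<nu>, \<tau>} \<le> 2"
    using independent_card_le[of "{n, \<nu>, \<tau>}"] by simp
  moreover have "n \<noteq> \<nu>" "n \<noteq> \<tau>" "\<nu> \<noteq> \<tau>" using assms \<open>n \<noteq> 0\<close> by (auto simp: norm_eq_1)
  then have "card {n, \<nu>, \<tau>} = 3" by simp
  ultimately show False by simp
qed

text \<open>Two disjoint sets with normals at \<open>x\<close> have opposite ones, so together they contain a piece of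
  every ray that is not tangent.  The complement of a Lipschitz domain contains near \<open>x\<close> a cone with
  nonempty interior, of which not all rays are tangent.\<close>

lemma lipschitz_domain_frontier_no_two_elements:
  assumes L: "lipschitz_domain \<Omega>" and x: "x \<in> frontier \<Omega>"
    and n: "is_outward_normal S x n" and m: "is_outward_normal T x m"
    and "S \<inter> T = {}" "S \<subseteq> \<Omega>" "T \<subseteq> \<Omega>"
  shows False
proof -
  obtain \<nu> \<tau> \<phi> L r where *: "norm \<nu> = 1" "norm \<tau> = 1" "\<nu> \<bullet> \<tau> = 0" "0 < r"
      "L-lipschitz_on UNIV (\<phi> :: real \<Rightarrow> real)"
      "\<And>y. y \<in> ball x r \<Longrightarrow> y \<in> \<Omega> \<longleftrightarrow> (y - x) \<bullet> \<nu> < \<phi> ((y - x) \<bullet> \<tau>)"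
    using L x unfolding lipschitz_domain_def by blast
  have "x \<notin> \<Omega>"
    using L x by (auto simp: lipschitz_domain_def frontier_def interior_open)
  then have \<phi>0: "\<phi> 0 \<le> 0" using *(6)[of x] \<open>0 < r\<close> by auto
  have L0: "L \<ge> 0" using *(5) by (rule lipschitz_on_nonneg)
  \<comment> \<open>The exterior cone of the Lipschitz graph.\<close>
  have outside: "\<forall>\<^sub>F t in at_right 0. x + t *\<^sub>R d \<notin> \<Omega>" if d: "L * \<bar>d \<bullet> \<tau>\<bar> \<le> d \<bullet> \<nu>" for d
  proof -
    have "((\<lambda>t. x + t *\<^sub>R d) \<longlongrightarrow> x + 0 *\<^sub>R d) (at_right 0)" by (intro tendsto_intros)
    then have "\<forall>\<^sub>F t in at_right 0. x + t *\<^sub>R d \<in> ball x r"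
      using \<open>0 < r\<close> by (intro topological_tendstoD) auto
    moreover have "\<forall>\<^sub>F t in at_right (0::real). t > 0" by (rule eventually_at_right_less)
    ultimately show ?thesis
    proof eventually_elim
      case (elim t)
      have "\<phi> (t * (d \<bullet> \<tau>)) \<le> \<phi> 0 + L * \<bar>t * (d \<bullet> \<tau>)\<bar>"
        using lipschitz_onD[OF *(5), of "t * (d \<bullet> \<tau>)" 0] by (auto simp: dist_real_def)
      also have "\<dots> \<le> t * (L * \<bar>d \<bullet> \<tau>\<bar>)" using \<phi>0 elim by (simp add: abs_mult)
      also have "\<dots> \<le> t * (d \<bullet> \<nu>)" using d elim by (intro mult_left_mono) auto
      finally show ?case using *(6)[OF elim(1)] by auto
    qed
  qed
  \<comment> \<open>Every ray of that cone is tangent, since otherwise it enters \<open>S\<close> or \<open>T\<close>.\<close>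
  have tangent: "d \<bullet> n = 0" if d: "L * \<bar>d \<bullet> \<tau>\<bar> \<le> d \<bullet> \<nu>" for d
  proof (rule ccontr)
    assume "d \<bullet> n \<noteq> 0"
    have "m = - n" using outward_normals_opposite assms by blast
    with \<open>d \<bullet> n \<noteq> 0\<close> have "d \<bullet> n < 0 \<or> d \<bullet> m < 0" by auto
    then have "\<forall>\<^sub>F t in at_right 0. x + t *\<^sub>R d \<in> \<Omega>"
    proof
      assume "d \<bullet> n < 0"
      from is_outward_normal_eventually_in[OF n this] show ?thesis
        by eventually_elim (use \<open>S \<subseteq> \<Omega>\<close> in blast)
    next
      assume "d \<bullet> m < 0"
      from is_outward_normal_eventually_in[OF m this] show ?thesis
        by eventually_elim (use \<open>T \<subseteq> \<Omega>\<close> in blast)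
    qed
    with outside[OF d] have "\<forall>\<^sub>F t in at_right (0::real). False" by eventually_elim simp
    then show False by simp
  qed
  have on: "\<nu> \<bullet> \<nu> = 1" "\<tau> \<bullet> \<tau> = 1" "\<tau> \<bullet> \<nu> = 0" using * by (auto simp: norm_eq_1 inner_commute)
  \<comment> \<open>Two linearly independent directions of the cone are orthogonal to \<open>n\<close>, so \<open>n = 0\<close>.\<close>
  have "\<nu> \<bullet> n = 0" using * on by (intro tangent) simp
  moreover have "(\<nu> + (1 / (L + 1)) *\<^sub>R \<tau>) \<bullet> n = 0"
    using * on L0 by (intro tangent) (simp add: inner_add_left)
  ultimately have "\<tau> \<bullet> n = 0" using L0 by (simp add: inner_add_left)
  with \<open>\<nu> \<bullet> n = 0\<close> have "n = 0"
    using orthonormal_span_real2[of \<nu> \<tau> n] * by (simp add: inner_commute)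
  then show False using n by (simp add: is_outward_normal_def)
qed

section \<open>Measurability of the outward normal\<close>

text \<open>At the scale \<open>t\<close> the set looks like the half plane \<open>(y - x) \<bullet> n < 0\<close>, and \<open>max 0 (d \<bullet> n)\<close> is the
  distance of \<open>d\<close> to it.  The distance to \<open>S\<close> depends continuously on \<open>x\<close>, which is what makes this
  derivative useful for measurability.\<close>

lemma infdist_directional_derivative:
  assumes n: "is_outward_normal S x n" and "S \<noteq> {}"
  shows "((\<lambda>t. infdist (x + t *\<^sub>R d) S / t) \<longlongrightarrow> max 0 (d \<bullet> n)) (at_right 0)"
proof (rule tendstoI)
  fix e :: real assume "e > 0"
  define \<eta> where "\<eta> = e / 2"
  have \<eta>: "\<eta> > 0" "\<eta> < e" using \<open>e > 0\<close> by (auto simp: \<eta>_def)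
  have nn: "n \<bullet> n = 1" "norm n = 1" using n by (auto simp: is_outward_normal_def norm_eq_1)
  \<comment> \<open>Upper bound: moving \<open>d\<close> by slightly more than its distance lands strictly inside the half plane.\<close>
  define a where "a = max 0 (d \<bullet> n) + \<eta>"
  have "(d - a *\<^sub>R n) \<bullet> n < 0" using \<eta> nn by (simp add: a_def inner_diff_left)
  from is_outward_normal_eventually_in[OF n this]
  have up: "\<forall>\<^sub>F t in at_right 0. x + t *\<^sub>R (d - a *\<^sub>R n) \<in> S" .
  \<comment> \<open>Lower bound: a competitor \<open>p\<close> closer than the base point \<open>x\<close> lies within \<open>2 * t * norm d\<close> of \<open>x\<close>,
    so it exceeds the tangent line by at most \<open>2 * \<epsilon> * t * norm d\<close>, which is at most \<open>\<eta> * t\<close>.\<close>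
  define \<epsilon> where "\<epsilon> = \<eta> / (2 * norm d + 1)"
  have pos: "2 * norm d + 1 > 0" using norm_ge_zero[of d] by linarith
  have \<epsilon>: "\<epsilon> > 0" using \<eta> pos by (simp add: \<epsilon>_def)
  have "\<epsilon> * (2 * norm d + 1) = \<eta>" using pos by (simp add: \<epsilon>_def)
  then have \<epsilon>d: "2 * (\<epsilon> * norm d) \<le> \<eta>" using \<epsilon> by (simp add: algebra_simps)
  obtain \<delta> where \<delta>: "\<delta> > 0"
    "\<And>y. y \<in> ball x \<delta> \<Longrightarrow> (y - x) \<bullet> n > \<epsilon> * norm (y - x) \<Longrightarrow> y \<notin> S"
    using n \<epsilon> unfolding is_outward_normal_def by metis
  have small: "\<forall>\<^sub>F t in at_right (0::real). t < \<delta> / (2 * norm d + 1)"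
    using \<delta>(1) pos by (intro eventually_at_rightI[of 0 "\<delta> / (2 * norm d + 1)"]) auto
  have "\<forall>\<^sub>F t in at_right (0::real). t > 0" by (rule eventually_at_right_less)
  with up small show "\<forall>\<^sub>F t in at_right 0. dist (infdist (x + t *\<^sub>R d) S / t) (max 0 (d \<bullet> n)) < e"
  proof eventually_elim
    case (elim t)
    have "x + t *\<^sub>R d - (x + t *\<^sub>R (d - a *\<^sub>R n)) = (t * a) *\<^sub>R n"
      by (simp add: algebra_simps)
    moreover have "a > 0" using \<eta> by (simp add: a_def)
    ultimately have "dist (x + t *\<^sub>R d) (x + t *\<^sub>R (d - a *\<^sub>R n)) = t * a"
      using elim nn by (simp add: dist_norm)
    then have upper: "infdist (x + t *\<^sub>R d) S \<le> t * a"
      using infdist_le[OF elim(1), of "x + t *\<^sub>R d"] by simp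
    have td: "t * (2 * norm d + 1) < \<delta>" using elim pos by (simp add: pos_less_divide_eq)
    have "t * (d \<bullet> n - \<eta>) \<le> dist (x + t *\<^sub>R d) p" if p: "p \<in> S" for p
    proof (cases "dist (x + t *\<^sub>R d) p < t * norm d")
      case False
      have "t * (d \<bullet> n - \<eta>) \<le> t * norm d"
        using norm_cauchy_schwarz[of d n] nn \<eta> elim by (intro mult_left_mono) auto
      with False show ?thesis by simp
    next
      case True
      have px: "norm (p - x) \<le> dist (x + t *\<^sub>R d) p + t * norm d"
        using norm_triangle_ineq4[of "t *\<^sub>R d" "x + t *\<^sub>R d - p"] elim by (simp add: dist_norm)
      then have "norm (p - x) < \<delta>" using td True elim by (simp add: algebra_simps)
      then have "p \<in> ball x \<delta>" by (simp add: dist_norm norm_minus_commute)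
      with \<delta>(2) p have "(p - x) \<bullet> n \<le> \<epsilon> * norm (p - x)" by force
      also have "\<dots> \<le> \<epsilon> * (2 * (t * norm d))" using \<epsilon> px True by (intro mult_left_mono) auto
      also have "\<dots> \<le> t * \<eta>" using mult_left_mono[OF \<epsilon>d, of t] elim by (simp add: algebra_simps)
      finally have 1: "(p - x) \<bullet> n \<le> t * \<eta>" .
      have "(x + t *\<^sub>R d - p) \<bullet> n \<le> dist (x + t *\<^sub>R d) p"
        using norm_cauchy_schwarz[of "x + t *\<^sub>R d - p" n] nn by (simp add: dist_norm)
      with 1 show ?thesis by (simp add: algebra_simps inner_diff_left inner_add_left)
    qed
    then have "t * (d \<bullet> n - \<eta>) \<le> infdist (x + t *\<^sub>R d) S"
      using \<open>S \<noteq> {}\<close> by (auto simp: infdist_def intro: cINF_greatest)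
    moreover have "0 \<le> infdist (x + t *\<^sub>R d) S" by (rule infdist_nonneg)
    ultimately have "d \<bullet> n - \<eta> \<le> infdist (x + t *\<^sub>R d) S / t" "0 \<le> infdist (x + t *\<^sub>R d) S / t"
        "infdist (x + t *\<^sub>R d) S / t \<le> a"
      using elim upper by (auto simp: pos_le_divide_eq pos_divide_le_eq mult.commute)
    then show ?case using \<eta> by (auto simp: dist_real_def a_def)
  qed
qed

text \<open>The limit of symmetric difference quotients of the distance to \<open>S\<close> in direction \<open>d\<close>: the one-sided
  derivatives \<open>max 0 (d \<bullet> n)\<close> and \<open>max 0 (- d \<bullet> n)\<close> differ by \<open>d \<bullet> n\<close>.  Unlike \<^const>\<open>outward_normal\<close>,
  it is visibly Borel measurable.\<close>

definition normal_component :: "(real^2) set \<Rightarrow> real^2 \<Rightarrow> real^2 \<Rightarrow> real" where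
  "normal_component S d x =
     lim (\<lambda>k. (infdist (x + inverse (real (Suc k)) *\<^sub>R d) S - infdist (x - inverse (real (Suc k)) *\<^sub>R d) S)
       / inverse (real (Suc k)))"

lemma normal_component_eq:
  assumes n: "is_outward_normal S x n" and "S \<noteq> {}"
  shows "normal_component S d x = outward_normal S x \<bullet> d"
proof -
  have "((\<lambda>t. infdist (x + t *\<^sub>R d) S / t - infdist (x + t *\<^sub>R (- d)) S / t) \<longlongrightarrow>
      max 0 (d \<bullet> n) - max 0 (- d \<bullet> n)) (at_right 0)"
    by (intro tendsto_diff infdist_directional_derivative assms)
  moreover have "filterlim (\<lambda>k. inverse (real (Suc k))) (at_right 0) sequentially"
    unfolding filterlim_at using LIMSEQ_inverse_real_of_nat by (auto simp: eventually_sequentially)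
  ultimately have "(\<lambda>k. infdist (x + inverse (real (Suc k)) *\<^sub>R d) S / inverse (real (Suc k))
        - infdist (x + inverse (real (Suc k)) *\<^sub>R (- d)) S / inverse (real (Suc k)))
      \<longlonglongrightarrow> max 0 (d \<bullet> n) - max 0 (- d \<bullet> n)"
    by (rule filterlim_compose)
  moreover have "max 0 (d \<bullet> n) - max 0 (- d \<bullet> n) = outward_normal S x \<bullet> d"
    using outward_normal_eq[OF n] by (simp add: inner_commute max_def)
  ultimately show ?thesis
    unfolding normal_component_def by (intro limI) (simp add: diff_divide_distrib)
qed

lemma borel_measurable_normal_component [measurable]:
  "normal_component S d \<in> borel_measurable borel"
proof -
  have "(\<lambda>x. (infdist (x + s *\<^sub>R d) S - infdist (x - s *\<^sub>R d) S) / s) \<in> borel_measurable borel" for s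
    by (intro borel_measurable_divide borel_measurable_diff borel_measurable_const 
        borel_measurable_continuous_onI continuous_intros)
  then show ?thesis unfolding normal_component_def[abs_def]
    by (intro borel_measurable_lim_metric)
qed

section \<open>Integrals with respect to arc length\<close>

lemma sets_borel_arc_length: "sets borel \<subseteq> sets (arc_length :: 'a::metric_space measure)"
proof -
  have "sets (measure_of UNIV (sets borel) hausdorff1) = sets (borel :: 'a measure)"
    using sets.sigma_sets_eq[of "borel :: 'a measure"] by simp
  then show ?thesis unfolding arc_length_def by (metis subsetI sets_completionI_sets)
qed

lemma space_arc_length [simp]: "space arc_length = UNIV"
  by (simp add: arc_length_def)

lemma borel_measurable_arc_length:
  fixes f :: "'a::metric_space \<Rightarrow> 'b::topological_space"
  assumes "f \<in> borel_measurable borel"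
  shows "f \<in> borel_measurable arc_length"
  using assms sets_borel_arc_length[where 'a='a] by (auto simp: measurable_def)

text \<open>Traces and normals are controlled only almost everywhere.  Arc length is a complete
  measure, so changing a function on a null set preserves even its measurability, and with it
  integrability and the integral.\<close>

lemma borel_measurable_cong_AE_arc_length:
  fixes f g :: "'a::metric_space \<Rightarrow> 'b::topological_space"
  assumes ae: "AE x in arc_length. f x = g x" and f: "f \<in> borel_measurable arc_length"
  shows "g \<in> borel_measurable arc_length"
proof (rule measurableI)
  interpret complete_measure "arc_length :: 'a measure"
    unfolding arc_length_def by (rule completion.complete_measure_axioms)
  fix A :: "'b set" assume "A \<in> sets borel"
  then have "f -` A \<in> sets arc_length" using measurable_sets[OF f] by simp
  moreover have "AE x in arc_length. x \<in> f -` A \<longleftrightarrow> x \<in> g -` A"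
    using ae by eventually_elim simp
  ultimately show "g -` A \<inter> space arc_length \<in> sets arc_length"
    using in_sets_AE[of "f -` A" "g -` A"] by simp
qed simp

lemma integral_cong_AE_arc_length:
  fixes f g :: "'a::metric_space \<Rightarrow> 'b::{banach, second_countable_topology}"
  assumes ae: "AE x in arc_length. f x = g x"
  shows "integral\<^sup>L arc_length f = integral\<^sup>L arc_length g"
proof (cases "f \<in> borel_measurable arc_length")
  case True
  with borel_measurable_cong_AE_arc_length[OF ae] ae show ?thesis
    by (intro integral_cong_AE) auto
next
  case False
  have "AE x in arc_length. g x = f x" using ae by eventually_elim simp
  with False have "g \<notin> borel_measurable arc_length"
    using borel_measurable_cong_AE_arc_length by blast
  with False show ?thesis
    by (metis borel_measurable_integrable not_integrable_integral_eq)
qed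

lemma set_integral_cong_AE_arc_length:
  fixes f g :: "'a::metric_space \<Rightarrow> 'b::{banach, second_countable_topology}"
  assumes ae: "AE x in arc_length. x \<in> A \<longrightarrow> f x = g x"
  shows "(LINT x:A|arc_length. f x) = (LINT x:A|arc_length. g x)"
  unfolding set_lebesgue_integral_def
  by (rule integral_cong_AE_arc_length) (use ae in eventually_elim, auto simp: indicator_def)

lemma set_integrable_cong_AE_arc_length:
  fixes f g :: "'a::metric_space \<Rightarrow> 'b::{banach, second_countable_topology}"
  assumes f: "set_integrable arc_length A f" and ae: "AE x in arc_length. x \<in> A \<longrightarrow> f x = g x"
  shows "set_integrable arc_length A g"
proof -
  have eq: "AE x in arc_length. indicator A x *\<^sub>R f x = indicator A x *\<^sub>R g x"
    using ae by eventually_elim (auto simp: indicator_def)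
  show ?thesis
    using f unfolding set_integrable_def
    by (rule integrable_cong_AE_imp[OF _ borel_measurable_cong_AE_arc_length[OF eq] eq])
      (use f in \<open>simp add: set_integrable_def borel_measurable_integrable\<close>)
qed

lemma set_integrable_bounded_AE_arc_length:
  fixes f h :: "'a::metric_space \<Rightarrow> 'b::{banach, second_countable_topology}"
  assumes A: "A \<in> sets borel" and fin: "emeasure arc_length A < \<infinity>" and h: "h \<in> borel_measurable borel"
    and ae: "AE x in arc_length. x \<in> A \<longrightarrow> f x = h x \<and> norm (h x) \<le> B"
  shows "set_integrable arc_length A f"
proof -
  have A': "A \<in> sets arc_length" using A sets_borel_arc_length by blast
  note h' = borel_measurable_arc_length[OF h]
  have "set_integrable arc_length A h"
    unfolding set_integrable_def
    using ae by (intro integrableI_bounded_set_indicator[OF A' h' fin]) auto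
  then show ?thesis
    by (rule set_integrable_cong_AE_arc_length) (use ae in eventually_elim, auto)
qed

lemma set_integrable_continuous_compact_arc_length:
  fixes f :: "'a::metric_space \<Rightarrow> 'b::{banach, second_countable_topology}"
  assumes A: "compact A" and fin: "emeasure arc_length A < \<infinity>" and f: "continuous_on UNIV f"
  shows "set_integrable arc_length A f"
proof -
  obtain B where "\<And>x. x \<in> A \<Longrightarrow> norm (f x) \<le> B"
    using compact_imp_bounded[OF compact_continuous_image[OF continuous_on_subset[OF f] A]]
    by (auto simp: bounded_iff)
  then show ?thesis
    using A fin f by (intro set_integrable_bounded_AE_arc_length[where h=f and B=B]) 
      (auto intro: borel_compact borel_measurable_continuous_onI)
qed

text \<open>The normal is replaced by \<^const>\<open>normal_component\<close>, which is measurable and agrees with it almost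
  everywhere; boundedness comes from the unit length of the normal and compactness.\<close>

lemma set_integrable_normal_component_square:
  fixes G :: "real^2 \<Rightarrow> complex^2"
  assumes A: "compact A" and fin: "emeasure arc_length A < \<infinity>" and G: "continuous_on UNIV G"
    and "S \<noteq> {}"
    and nrm: "AE x in arc_length. x \<in> A \<longrightarrow> is_outward_normal S x (outward_normal S x)"
  shows "set_integrable arc_length A
    (\<lambda>x. (norm (\<Sum>k\<in>UNIV. G x $ k * of_real (outward_normal S x $ k)))\<^sup>2)"
proof -
  define h where "h x = (norm (\<Sum>k\<in>UNIV. G x $ k * of_real (normal_component S (axis k 1) x)))\<^sup>2" for x
  have "continuous_on UNIV (\<lambda>x. \<Sum>k\<in>UNIV. norm (G x $ k))" using G by (intro continuous_intros)
  from compact_imp_bounded[OF compact_continuous_image[OF continuous_on_subset[OF this] A]]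
  obtain B where B: "\<And>x. x \<in> A \<Longrightarrow> (\<Sum>k\<in>UNIV. norm (G x $ k)) \<le> B"
    by (auto simp: bounded_iff intro: order_trans[OF abs_ge_self])
  have meas: "(\<lambda>x. G x $ k) \<in> borel_measurable borel" for k
    using G by (intro borel_measurable_continuous_onI continuous_intros)
  show ?thesis
  proof (rule set_integrable_bounded_AE_arc_length[where h=h and B="B\<^sup>2"])
    show "h \<in> borel_measurable borel" unfolding h_def using meas by measurable
    show "AE x in arc_length. x \<in> A \<longrightarrow>
        (norm (\<Sum>k\<in>UNIV. G x $ k * of_real (outward_normal S x $ k)))\<^sup>2 = h x \<and> norm (h x) \<le> B\<^sup>2"
      using nrm
    proof eventually_elim
      case (elim x)
      show ?case
      proof
        assume x: "x \<in> A"
        with elim have n: "is_outward_normal S x (outward_normal S x)" by simp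
        have nc: "normal_component S (axis k 1) x = outward_normal S x $ k" for k
          using normal_component_eq[OF n \<open>S \<noteq> {}\<close>] by (simp add: inner_axis)
        have "norm (\<Sum>k\<in>UNIV. G x $ k * of_real (outward_normal S x $ k)) \<le>
            (\<Sum>k\<in>UNIV. norm (G x $ k) * 1)"
        proof (rule sum_norm_le)
          fix k
          have "\<bar>outward_normal S x $ k\<bar> \<le> 1"
            using component_le_norm_cart[of "outward_normal S x" k] n by (simp add: is_outward_normal_def)
          then show "norm (G x $ k * of_real (outward_normal S x $ k)) \<le> norm (G x $ k) * 1"
            unfolding norm_mult norm_of_real by (intro mult_left_mono) auto
        qed
        also have "\<dots> \<le> B" using B[OF x] by simp
        finally show "(norm (\<Sum>k\<in>UNIV. G x $ k * of_real (outward_normal S x $ k)))\<^sup>2 = h x \<and>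
            norm (h x) \<le> B\<^sup>2"
          unfolding h_def nc by (simp add: power_mono)
      qed
    qed
  qed (use A fin in \<open>auto intro: borel_compact\<close>)
qed

section \<open>Smooth extensions of Trefftz fields\<close>

lemma grad_eqI:
  assumes "(w has_derivative D) (at x)" "\<And>k. D (axis k 1) = G $ k"
  shows "grad w x = G"
  unfolding grad_def frechet_derivative_at[OF assms(1), symmetric] assms(2) by (rule vec_lambda_eta)

lemma grad_component: "grad w x $ k = frechet_derivative w (at x) (axis k 1)"
  by (simp add: grad_def)

lemma grad_diff:
  assumes "u differentiable (at x)" "v differentiable (at x)"
  shows "grad (\<lambda>x. u x - v x) x = grad u x - grad v x"
proof (rule grad_eqI)
  show "((\<lambda>x. u x - v x) has_derivative
      (\<lambda>h. frechet_derivative u (at x) h - frechet_derivative v (at x) h)) (at x)"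
    using assms unfolding frechet_derivative_works by (rule has_derivative_diff)
qed (simp add: grad_component)

lemma grad_cong_open:
  assumes "open S" "x \<in> S" "\<And>y. y \<in> S \<Longrightarrow> w y = v y" "v differentiable (at x)"
  shows "grad w x = grad v x"
proof -
  have "frechet_derivative v (at x) = frechet_derivative w (at x)"
    using assms(3) by (intro frechet_derivative_transform_within_open[OF assms(4,1,2)]) simp
  then show ?thesis by (simp add: grad_def)
qed

text \<open>On the whole plane, so that values of the field and of its gradient on the frontier of an element
  are available as limits from inside.\<close>

definition C1_field :: "(real^2 \<Rightarrow> complex) \<Rightarrow> bool" where
  "C1_field V \<longleftrightarrow> (\<forall>x. V differentiable (at x)) \<and> continuous_on UNIV (grad V)"

lemma C1_field_0: "C1_field (\<lambda>x. 0)"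
proof -
  have "grad (\<lambda>x. 0) = (\<lambda>x. 0)" by (rule ext, rule grad_eqI[OF has_derivative_const]) simp
  then show ?thesis by (simp add: C1_field_def)
qed

lemma C1_field_add_cmult:
  assumes "C1_field V" "C1_field W"
  shows "C1_field (\<lambda>x. c * V x + W x)"
proof -
  have d: "V differentiable (at x)" "W differentiable (at x)" for x
    using assms by (auto simp: C1_field_def)
  have "grad (\<lambda>x. c * V x + W x) x = (\<chi> k. c * grad V x $ k + grad W x $ k)" for x
  proof (rule grad_eqI)
    show "((\<lambda>x. c * V x + W x) has_derivative
        (\<lambda>h. c * frechet_derivative V (at x) h + frechet_derivative W (at x) h)) (at x)"
      using d[of x] unfolding frechet_derivative_works
      by (intro has_derivative_add has_derivative_mult_right)
  qed (simp add: grad_component)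
  then have "grad (\<lambda>x. c * V x + W x) = (\<lambda>x. \<chi> k. c * grad V x $ k + grad W x $ k)" by blast
  moreover have "continuous_on UNIV (\<lambda>x. \<chi> k. c * grad V x $ k + grad W x $ k)"
    using assms unfolding C1_field_def
    by (intro continuous_on_vec_lambda continuous_on_add continuous_on_mult_left continuous_on_component) simp_all
  moreover have "(\<lambda>x. c * V x + W x) differentiable (at x)" for x
    using d[of x] by (intro differentiable_add differentiable_mult differentiable_const)
  ultimately show ?thesis by (simp add: C1_field_def)
qed

lemma C1_field_linear_combination:
  assumes "\<And>m. m < n \<Longrightarrow> C1_field (E m)"
  shows "C1_field (\<lambda>x. \<Sum>m<(n::nat). c m * E m x)"
  using assms
proof (induction n)
  case (Suc n)
  then have "C1_field (\<lambda>x. c n * E n x + (\<Sum>m<n. c m * E m x))"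
    by (intro C1_field_add_cmult) auto
  then show ?case by (simp add: add.commute)
qed (simp add: C1_field_0)

lemma C1_field_exp:
  "C1_field (\<lambda>x. exp (\<i> * (\<Sum>l\<in>UNIV. q $ l * of_real ((x - x0) $ l))))"
proof -
  define E where "E x = exp (\<i> * (\<Sum>l\<in>UNIV. q $ l * of_real ((x - x0) $ l)))" for x :: "real^2"
  have D: "(E has_derivative (\<lambda>h. E x * (\<i> * (\<Sum>l\<in>UNIV. q $ l * of_real (h $ l))))) (at x)" for x
  proof -
    have "((\<lambda>x. \<Sum>l\<in>UNIV. q $ l * complex_of_real ((x - x0) $ l)) has_derivative
        (\<lambda>h. \<Sum>l\<in>UNIV. q $ l * of_real ((h - 0) $ l))) (at x)"
      by (intro has_derivative_sum has_derivative_mult_right has_derivative_of_real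
          bounded_linear.has_derivative[OF bounded_linear_vec_nth] has_derivative_diff
          has_derivative_ident has_derivative_const)
    then have "((\<lambda>x. \<i> * (\<Sum>l\<in>UNIV. q $ l * complex_of_real ((x - x0) $ l))) has_derivative
        (\<lambda>h. \<i> * (\<Sum>l\<in>UNIV. q $ l * of_real (h $ l)))) (at x)"
      by (intro has_derivative_mult_right) simp
    from has_derivative_compose[OF this, of exp] DERIV_exp[THEN has_field_derivative_imp_has_derivative]
    show ?thesis unfolding E_def by blast
  qed
  then have cont: "continuous_on UNIV E"
    by (meson continuous_at_imp_continuous_on has_derivative_continuous)
  have "grad E x = (\<chi> k. E x * (\<i> * q $ k))" for x
    by (rule grad_eqI[OF D]) (simp add: axis_def if_distrib[of complex_of_real] if_distrib[of "(*) _"] cong: if_cong)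
  then have "grad E = (\<lambda>x. \<chi> k. E x * (\<i> * q $ k))" by blast
  moreover have "continuous_on UNIV (\<lambda>x. \<chi> k. E x * (\<i> * q $ k))"
    using cont by (intro continuous_on_vec_lambda continuous_on_mult continuous_on_const)
  ultimately have "C1_field E" using D by (auto simp: C1_field_def differentiable_def)
  then show ?thesis unfolding E_def .
qed

text \<open>On one element, the basis functions of the other elements vanish and those of the element itself
  are restrictions of exponentials.\<close>

lemma trefftz_field_C1_extension:
  assumes disj: "\<And>j. j < N \<Longrightarrow> j \<noteq> i \<Longrightarrow> K i \<inter> K j = {}"
  obtains V where "C1_field V" "\<And>x. x \<in> K i \<Longrightarrow> trefftz_field N K \<kappa> xr c Z x = V x"
proof -
  define b where "b = trefftz_basis N K \<kappa> xr Z"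
  have "\<exists>E. C1_field E \<and> (\<forall>x\<in>K i. (b ! m) x = E x)" if "m < length b" for m
  proof -
    have "b ! m \<in> set b" using that by simp
    then obtain j z where jz: "j < N" "b ! m = plane_wave (K j) (\<kappa> j) (xr j) z"
      by (auto simp: b_def trefftz_basis_def)
    show ?thesis
    proof (cases "j = i")
      case True
      then show ?thesis
        using C1_field_exp[of "wave_vector (\<kappa> i) z" "xr i"] jz by (auto simp: plane_wave_def)
    next
      case False
      then have "\<forall>x\<in>K i. (b ! m) x = 0" using disj jz by (auto simp: plane_wave_def)
      then show ?thesis using C1_field_0 by blast
    qed
  qed
  then obtain E where E: "\<And>m. m < length b \<Longrightarrow> C1_field (E m)"
      "\<And>m x. m < length b \<Longrightarrow> x \<in> K i \<Longrightarrow> (b ! m) x = E m x"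
    by metis
  show ?thesis
  proof (rule that)
    show "C1_field (\<lambda>x. \<Sum>m<length b. c m * E m x)" using E(1) by (rule C1_field_linear_combination)
    show "trefftz_field N K \<kappa> xr c Z x = (\<Sum>m<length b. c m * E m x)" if "x \<in> K i" for x
      using E(2)[OF _ that] by (simp add: trefftz_field_def b_def)
  qed
qed

section \<open>Traces and jumps\<close>

lemma side_trace_eqI:
  "((\<lambda>t. w (x - t *\<^sub>R outward_normal S x)) \<longlongrightarrow> l) (at_right 0) \<Longrightarrow> side_trace S w x = l"
  unfolding side_trace_def by (intro tendsto_Lim) auto

lemma has_side_traceD:
  "has_side_trace S w x \<Longrightarrow>
    ((\<lambda>t. w (x - t *\<^sub>R outward_normal S x)) \<longlongrightarrow> side_trace S w x) (at_right 0)"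
  unfolding has_side_trace_def using side_trace_eqI by metis

lemma eventually_inward_normal_ray:
  assumes "is_outward_normal S x n"
  shows "\<forall>\<^sub>F t in at_right 0. x - t *\<^sub>R outward_normal S x \<in> S"
proof -
  have "(- n) \<bullet> n < 0" using assms by (simp add: is_outward_normal_def norm_eq_1)
  from is_outward_normal_eventually_in[OF assms this] show ?thesis
    using outward_normal_eq[OF assms] by simp
qed

lemma tendsto_trace_continuous:
  assumes n: "is_outward_normal S x n" and "isCont V x" and eq: "\<And>y. y \<in> S \<Longrightarrow> w y = V y"
  shows "((\<lambda>t. w (x - t *\<^sub>R outward_normal S x)) \<longlongrightarrow> V x) (at_right 0)"
proof -
  have "((\<lambda>t. x - t *\<^sub>R outward_normal S x) \<longlongrightarrow> x - 0 *\<^sub>R outward_normal S x) (at_right 0)"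
    by (intro tendsto_intros)
  then have "((\<lambda>t. V (x - t *\<^sub>R outward_normal S x)) \<longlongrightarrow> V x) (at_right 0)"
    using isCont_tendsto_compose[OF assms(2)] by simp
  moreover have "\<forall>\<^sub>F t in at_right 0. V (x - t *\<^sub>R outward_normal S x) = w (x - t *\<^sub>R outward_normal S x)"
    using eventually_inward_normal_ray[OF n] by eventually_elim (simp add: eq)
  ultimately show ?thesis by (rule Lim_transform_eventually)
qed

lemma side_trace_diff:
  fixes u v w :: "real^2 \<Rightarrow> 'b::real_normed_vector"
  assumes n: "is_outward_normal S x n" and "has_side_trace S u x" "has_side_trace S v x"
    and eq: "\<And>y. y \<in> S \<Longrightarrow> w y = u y - v y"
  shows "side_trace S w x = side_trace S u x - side_trace S v x"
proof (rule side_trace_eqI)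
  have "((\<lambda>t. u (x - t *\<^sub>R outward_normal S x) - v (x - t *\<^sub>R outward_normal S x)) \<longlongrightarrow>
      side_trace S u x - side_trace S v x) (at_right 0)"
    using assms by (intro tendsto_diff has_side_traceD)
  moreover have "\<forall>\<^sub>F t in at_right 0. u (x - t *\<^sub>R outward_normal S x) - v (x - t *\<^sub>R outward_normal S x)
      = w (x - t *\<^sub>R outward_normal S x)"
    using eventually_inward_normal_ray[OF n] by eventually_elim (simp add: eq)
  ultimately show "((\<lambda>t. w (x - t *\<^sub>R outward_normal S x)) \<longlongrightarrow>
      side_trace S u x - side_trace S v x) (at_right 0)"
    by (rule Lim_transform_eventually)
qed

lemma traces_of_C1_extension:
  assumes "is_outward_normal S x n" "open S" "C1_field V" "\<And>y. y \<in> S \<Longrightarrow> v y = V y"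
  shows "has_side_trace S v x" "side_trace S v x = V x"
    "has_side_trace S (grad v) x" "side_trace S (grad v) x = grad V x"
proof -
  have V: "V differentiable (at y)" "isCont (grad V) y" for y
    using assms(3) by (simp_all add: C1_field_def continuous_on_eq_continuous_at)
  have "isCont V x" using V(1) by (rule differentiable_imp_continuous_within)
  from tendsto_trace_continuous[OF assms(1) this assms(4)]
  have 1: "((\<lambda>t. v (x - t *\<^sub>R outward_normal S x)) \<longlongrightarrow> V x) (at_right 0)" .
  have "grad v y = grad V y" if "y \<in> S" for y
    using grad_cong_open[OF assms(2) that assms(4) V(1)] .
  from tendsto_trace_continuous[OF assms(1) V(2) this]
  have 2: "((\<lambda>t. grad v (x - t *\<^sub>R outward_normal S x)) \<longlongrightarrow> grad V x) (at_right 0)" .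
  show "has_side_trace S v x" "has_side_trace S (grad v) x"
    using 1 2 unfolding has_side_trace_def by blast+
  show "side_trace S v x = V x" "side_trace S (grad v) x = grad V x"
    by (rule side_trace_eqI[OF 1], rule side_trace_eqI[OF 2])
qed

text \<open>With opposite normals, both jumps are expressed through the difference of the two traces and the
  normal of \<open>S\<close> alone; in particular they vanish when the traces agree.\<close>

lemma jump_eq:
  assumes "outward_normal T x = - outward_normal S x"
  shows "jump S T w x = (\<chi> k. (side_trace S w x - side_trace T w x) * of_real (outward_normal S x $ k))"
  using assms by (simp add: jump_def algebra_simps)

lemma normal_jump_eq:
  assumes "outward_normal T x = - outward_normal S x"
  shows "normal_jump S T \<tau> x =
    (\<Sum>k\<in>UNIV. (side_trace S \<tau> x - side_trace T \<tau> x) $ k * of_real (outward_normal S x $ k))"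
  using assms
  by (simp add: normal_jump_def normal_trace_def left_diff_distrib sum_subtractf sum_negf)

lemma sum_mult_cnj_self:
  fixes z :: "complex^'n"
  shows "(\<Sum>k\<in>UNIV. z $ k * cnj (z $ k)) = of_real ((norm z)\<^sup>2)"
  by (simp add: norm_vec_def L2_set_def sum_nonneg complex_norm_square del: of_real_power)

lemma norm_jump:
  assumes n: "is_outward_normal S x n" and "outward_normal T x = - outward_normal S x"
  shows "norm (jump S T w x) = norm (side_trace S w x - side_trace T w x)"
proof -
  have "norm (outward_normal S x) = 1"
    using n outward_normal_eq[OF n] by (simp add: is_outward_normal_def)
  then have "(\<Sum>k\<in>UNIV. (outward_normal S x $ k)\<^sup>2) = 1"
    by (simp add: norm_vec_def L2_set_def)
  then show ?thesis
    unfolding jump_eq[OF assms(2)]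
    by (simp add: norm_vec_def L2_set_def norm_mult power_mult_distrib sum_distrib_left[symmetric])
qed

section \<open>Geometry of meshes\<close>

lemma mesh_normals:
  assumes "is_mesh \<Omega> N K"
  shows "AE x in arc_length. \<forall>i<N. x \<in> frontier (K i) \<longrightarrow> is_outward_normal (K i) x (outward_normal (K i) x)"
  unfolding AE_all_countable
proof
  fix i
  show "AE x in arc_length. i < N \<longrightarrow> x \<in> frontier (K i) \<longrightarrow>
      is_outward_normal (K i) x (outward_normal (K i) x)"
  proof (cases "i < N")
    case True
    with assms have "AE x in arc_length. x \<in> frontier (K i) \<longrightarrow> (\<exists>n. is_outward_normal (K i) x n)"
      by (simp add: is_mesh_def)
    then show ?thesis by eventually_elim (metis outward_normal_eq)
  qed simp
qed

lemma mesh_elements: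
  assumes "is_mesh \<Omega> N K" "i < N"
  shows "open (K i)" "K i \<noteq> {}" "K i \<subseteq> \<Omega>" "emeasure arc_length (frontier (K i)) < \<infinity>"
  using assms by (auto simp: is_mesh_def)

lemma mesh_disjoint:
  assumes "is_mesh \<Omega> N K" "i < N" "j < N" "i \<noteq> j"
  shows "K i \<inter> K j = {}"
  using assms by (auto simp: is_mesh_def)

lemma mesh_disjoint_frontier:
  assumes "is_mesh \<Omega> N K" "i < N" "j < N"
  shows "K i \<inter> frontier (K j) = {}"
proof (cases "i = j")
  case True
  then show ?thesis using mesh_elements(1)[OF assms(1,3)] by (auto simp: frontier_def interior_open)
next
  case False
  then have "K i \<inter> closure (K j) = {}"
    using mesh_disjoint[OF assms] mesh_elements(1)[OF assms(1,2)] by (simp add: open_Int_closure_eq_empty)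
  then show ?thesis by (auto simp: frontier_def)
qed

lemma interior_edgesD:
  assumes "(i, j) \<in> interior_edges N K"
  shows "i < N" "j < N" "i < j"
  using assms by (auto simp: interior_edges_def)

lemma C2_on_isCont:
  assumes "C2_on S u" "x \<in> S"
  shows "isCont u x" "isCont (grad u) x"
proof -
  have "u differentiable (at x)" using assms by (simp add: C2_on_def)
  then show "isCont u x" by (rule differentiable_imp_continuous_within)
  have "isCont (\<lambda>y. grad u y $ k) x" for k
    using assms by (intro differentiable_imp_continuous_within) (simp add: C2_on_def)
  then show "isCont (grad u) x" unfolding isCont_def by (intro vec_tendstoI)
qed

lemma edge_point_in_domain:
  assumes mesh: "is_mesh \<Omega> N K" and dom: "lipschitz_domain \<Omega>" and ij: "i < N" "j < N" "i \<noteq> j"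
    and nrm: "\<forall>i<N. x \<in> frontier (K i) \<longrightarrow> is_outward_normal (K i) x (outward_normal (K i) x)"
    and x: "x \<in> edge K i j"
  shows "x \<in> \<Omega>"
proof (rule ccontr)
  assume "x \<notin> \<Omega>"
  have f: "x \<in> frontier (K i)" "x \<in> frontier (K j)" using x by (auto simp: edge_def)
  then have "x \<in> closure \<Omega>"
    using closure_mono[OF mesh_elements(3)[OF mesh ij(1)]] by (auto simp: frontier_def)
  with \<open>x \<notin> \<Omega>\<close> have "x \<in> frontier \<Omega>" using interior_subset by (auto simp: frontier_def)
  then show False
    using lipschitz_domain_frontier_no_two_elements[OF dom _ _ _ mesh_disjoint[OF mesh ij]
        mesh_elements(3)[OF mesh ij(1)] mesh_elements(3)[OF mesh ij(2)]] nrm f ij by blast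
qed

text \<open>Two different pairs of elements involve at least three elements.\<close>

lemma edge_point_in_one_edge_only:
  assumes mesh: "is_mesh \<Omega> N K" and ij: "(i, j) \<in> interior_edges N K" and kl: "(k, l) \<in> interior_edges N K"
    and nrm: "\<forall>i<N. x \<in> frontier (K i) \<longrightarrow> is_outward_normal (K i) x (outward_normal (K i) x)"
    and x: "x \<in> edge K i j" "x \<in> edge K k l"
  shows "(i, j) = (k, l)"
proof (rule ccontr)
  assume ne: "(i, j) \<noteq> (k, l)"
  note D = interior_edgesD[OF ij] interior_edgesD[OF kl]
  have "\<exists>m<N. m \<noteq> i \<and> m \<noteq> j \<and> x \<in> frontier (K m)"
  proof (cases "k = i \<or> k = j")
    case True
    then have "l \<noteq> i" "l \<noteq> j" using ne D by auto
    then show ?thesis using D x unfolding edge_def by blast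
  next
    case False
    have "k < N" using D by simp
    then show ?thesis using False x unfolding edge_def by blast
  qed
  then obtain m where m: "m < N" "m \<noteq> i" "m \<noteq> j" "x \<in> frontier (K m)" by blast
  have "is_outward_normal (K p) x (outward_normal (K p) x)" if "p \<in> {i, j, m}" for p
    using that nrm m D x by (auto simp: edge_def)
  then show False
    using no_three_disjoint_sets_with_normals[of "K i" x _ "K j" _ "K m"] mesh_disjoint[OF mesh] m D
    by (metis insertCI less_irrefl)
qed

text \<open>An edge that is not a material interface lies, up to a null set, in the open part of the domain
  where \<open>u\<close> is twice differentiable, so both one-sided traces are the values of \<open>u\<close> and of its
  gradient.\<close>

lemma exact_solution_jumps_vanish:
  assumes dom: "lipschitz_domain \<Omega>" and mesh: "is_mesh \<Omega> N K"
    and mat: "material_interfaces N K \<kappa> I" and sol: "exact_solution \<Omega> N K \<kappa> I g u"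
    and ij: "(i, j) \<in> interior_edges N K"
  shows "AE x in arc_length. x \<in> edge K i j \<longrightarrow>
    side_trace (K i) u x = side_trace (K j) u x \<and> normal_jump (K i) (K j) (grad u) x = 0"
proof (cases "(i, j) \<in> I")
  case True
  with sol show ?thesis by (auto simp: exact_solution_def)
next
  case False
  note D = interior_edgesD[OF ij]
  define S where "S = \<Omega> - (\<Union>(i, j)\<in>I. edge K i j)"
  have C2: "C2_on S u" using sol by (simp add: exact_solution_def S_def Let_def)
  show ?thesis
    using mesh_normals[OF mesh]
  proof eventually_elim
    case (elim x)
    show ?case
    proof
      assume x: "x \<in> edge K i j"
      have "x \<in> \<Omega>" using edge_point_in_domain[OF mesh dom _ _ _ elim x] D by simp
      moreover have "x \<notin> edge K k l" if kl: "(k, l) \<in> I" for k l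
      proof
        assume "x \<in> edge K k l"
        moreover have "(k, l) \<in> interior_edges N K" using kl mat by (auto simp: material_interfaces_def)
        ultimately have "(i, j) = (k, l)" using edge_point_in_one_edge_only[OF mesh ij _ elim x] by blast
        with kl False show False by simp
      qed
      ultimately have "x \<in> S" by (auto simp: S_def)
      note cont = C2_on_isCont[OF C2 this]
      have n: "is_outward_normal (K i) x (outward_normal (K i) x)"
          "is_outward_normal (K j) x (outward_normal (K j) x)"
        using elim D x by (auto simp: edge_def)
      have tr: "side_trace (K i) u x = u x" "side_trace (K j) u x = u x"
          "side_trace (K i) (grad u) x = grad u x" "side_trace (K j) (grad u) x = grad u x"
        by (rule side_trace_eqI, rule tendsto_trace_continuous[OF n(1)] tendsto_trace_continuous[OF n(2)],
            rule cont, rule refl)+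
      have "outward_normal (K j) x = - outward_normal (K i) x"
        using outward_normals_opposite[OF n] mesh_disjoint[OF mesh] D by simp
      from normal_jump_eq[OF this] tr
      show "side_trace (K i) u x = side_trace (K j) u x \<and> normal_jump (K i) (K j) (grad u) x = 0"
        by simp
    qed
  qed
qed

text \<open>Elements are open and disjoint, so no interface enters them.  This allows the gradient of the error
  to be split inside each element.\<close>

lemma exact_solution_differentiable_on_elements:
  assumes mesh: "is_mesh \<Omega> N K" and mat: "material_interfaces N K \<kappa> I"
    and sol: "exact_solution \<Omega> N K \<kappa> I g u" and "i < N" "y \<in> K i"
  shows "u differentiable (at y)"
proof -
  define S where "S = \<Omega> - (\<Union>(i, j)\<in>I. edge K i j)"
  have C2: "C2_on S u" using sol by (simp add: exact_solution_def S_def Let_def)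
  have "y \<notin> edge K k l" if "(k, l) \<in> I" for k l
  proof -
    have "k < N" using that mat by (auto simp: material_interfaces_def interior_edges_def)
    then show ?thesis using mesh_disjoint_frontier[OF mesh \<open>i < N\<close>] \<open>y \<in> K i\<close> by (auto simp: edge_def)
  qed
  then have "y \<in> S" using mesh_elements(3)[OF mesh \<open>i < N\<close>] \<open>y \<in> K i\<close> by (auto simp: S_def)
  then show ?thesis using C2 by (simp add: C2_on_def)
qed

text \<open>The pointwise form of the identity on an interior edge.  The last two conclusions rewrite the jumps
  of \<open>v\<close> in terms whose measurability and boundedness are known.\<close>

lemma error_jumps:
  fixes v :: "real^2 \<Rightarrow> complex"
  assumes mesh: "is_mesh \<Omega> N K" and D: "i < N" "j < N" "i \<noteq> j"
    and udiff: "\<And>k y. k < N \<Longrightarrow> y \<in> K k \<Longrightarrow> u differentiable (at y)"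
    and V: "\<And>k. k < N \<Longrightarrow> C1_field (V k)" "\<And>k y. k < N \<Longrightarrow> y \<in> K k \<Longrightarrow> v y = V k y"
    and nrm: "\<forall>i<N. x \<in> frontier (K i) \<longrightarrow> is_outward_normal (K i) x (outward_normal (K i) x)"
    and x: "x \<in> edge K i j"
    and tr: "\<And>k. k \<in> {i, j} \<Longrightarrow> has_side_trace (K k) u x \<and> has_side_trace (K k) (grad u) x"
    and u: "side_trace (K i) u x = side_trace (K j) u x" "normal_jump (K i) (K j) (grad u) x = 0"
  defines "err \<equiv> \<lambda>x. u x - v x"
  shows "jump (K i) (K j) err x = - jump (K i) (K j) v x"
    "normal_jump (K i) (K j) (grad err) x = - normal_jump (K i) (K j) (grad v) x"
    "norm (jump (K i) (K j) v x) = norm (V i x - V j x)"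
    "normal_jump (K i) (K j) (grad v) x =
      (\<Sum>k\<in>UNIV. (grad (V i) x - grad (V j) x) $ k * of_real (outward_normal (K i) x $ k))"
proof -
  have n: "is_outward_normal (K k) x (outward_normal (K k) x)" if "k \<in> {i, j}" for k
    using nrm D x that by (auto simp: edge_def)
  have lt: "k < N" if "k \<in> {i, j}" for k using that D by auto
  have opp: "outward_normal (K j) x = - outward_normal (K i) x"
    using outward_normals_opposite[of "K i" x _ "K j"] n mesh_disjoint[OF mesh D] by simp
  note vt = traces_of_C1_extension[OF n mesh_elements(1)[OF mesh] V]
  have gerr: "grad err y = grad u y - grad v y" if "k \<in> {i, j}" "y \<in> K k" for k y
  proof -
    have dV: "V k differentiable (at y)" using V(1)[OF lt[OF that(1)]] by (simp add: C1_field_def)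
    have "v differentiable (at y)"
      using has_derivative_transform_within_open[OF _ mesh_elements(1)[OF mesh lt[OF that(1)]] that(2)]
        dV V(2)[OF lt[OF that(1)]] unfolding differentiable_def by metis
    then show ?thesis
      unfolding err_def using udiff[OF lt[OF that(1)] that(2)] by (intro grad_diff)
  qed
  have st: "side_trace (K k) err x = side_trace (K k) u x - side_trace (K k) v x"
      "side_trace (K k) (grad err) x = side_trace (K k) (grad u) x - side_trace (K k) (grad v) x"
    if k: "k \<in> {i, j}" for k
  proof -
    show "side_trace (K k) err x = side_trace (K k) u x - side_trace (K k) v x"
      using tr[OF k] vt(1)[OF k lt[OF k] lt[OF k]] lt[OF k]
      by (intro side_trace_diff[OF n[OF k]]) (auto simp: err_def)
    show "side_trace (K k) (grad err) x = side_trace (K k) (grad u) x - side_trace (K k) (grad v) x"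
      using tr[OF k] vt(3)[OF k lt[OF k] lt[OF k]] lt[OF k] gerr[OF k]
      by (intro side_trace_diff[OF n[OF k]]) auto
  qed
  show "jump (K i) (K j) err x = - jump (K i) (K j) v x"
    using st(1)[of i] st(1)[of j] u(1) by (simp add: jump_eq[OF opp] vec_eq_iff left_diff_distrib)
  have "normal_jump (K i) (K j) (grad err) x =
      normal_jump (K i) (K j) (grad u) x - normal_jump (K i) (K j) (grad v) x"
    using st(2)[of i] st(2)[of j]
    by (simp add: normal_jump_eq[OF opp] left_diff_distrib sum_subtractf)
  then show "normal_jump (K i) (K j) (grad err) x = - normal_jump (K i) (K j) (grad v) x"
    using u(2) by simp
  show "norm (jump (K i) (K j) v x) = norm (V i x - V j x)"
    using norm_jump[OF n opp] vt(2) D by simp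
  show "normal_jump (K i) (K j) (grad v) x =
      (\<Sum>k\<in>UNIV. (grad (V i) x - grad (V j) x) $ k * of_real (outward_normal (K i) x $ k))"
    unfolding normal_jump_eq[OF opp] using vt(4) D by simp
qed

section \<open>Residual and graph norm of the error\<close>

theorem proposition4p1:
  fixes \<Omega> :: "(real^2) set" and N :: nat and K :: "nat \<Rightarrow> (real^2) set"
    and \<kappa> :: "nat \<Rightarrow> real" and I :: "(nat \<times> nat) set"
    and g u :: "real^2 \<Rightarrow> complex" and \<alpha> \<beta> :: real
    and xr :: "nat \<Rightarrow> real^2" and c :: "nat \<Rightarrow> complex" and Z :: "nat \<Rightarrow> complex list"
  assumes "lipschitz_domain \<Omega>"
    and "is_mesh \<Omega> N K"
    and "\<And>i. i < N \<Longrightarrow> 0 < \<kappa> i"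
    and "material_interfaces N K \<kappa> I"
    and "exact_solution \<Omega> N K \<kappa> I g u"
    and "has_edge_traces \<Omega> N K u"
    and "square_integrable_on (frontier \<Omega>) g"
    and "0 < \<alpha>" and "0 < \<beta>"
  shows "let err = (\<lambda>x. u x - trefftz_field N K \<kappa> xr c Z x) in
     complex_of_real (residual \<Omega> N K \<kappa> \<alpha> \<beta> xr g c Z) = graph_form \<Omega> N K \<kappa> \<alpha> \<beta> err err \<and>
     graph_form \<Omega> N K \<kappa> \<alpha> \<beta> err err = complex_of_real ((graph_norm \<Omega> N K \<kappa> \<alpha> \<beta> err)\<^sup>2)"
proof -
  note mesh = \<open>is_mesh \<Omega> N K\<close> and \<kappa> = assms(3)
  define v where "v = trefftz_field N K \<kappa> xr c Z"
  define err where "err x = u x - v x" for x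
  have "\<exists>V. C1_field V \<and> (\<forall>y\<in>K k. v y = V y)" if "k < N" for k
    using trefftz_field_C1_extension[of N k K \<kappa> xr c Z] mesh_disjoint[OF mesh that]
    unfolding v_def by (metis (no_types, lifting))
  then obtain V where V: "\<And>k. k < N \<Longrightarrow> C1_field (V k)" "\<And>k y. k < N \<Longrightarrow> y \<in> K k \<Longrightarrow> v y = V k y"
    by metis
  note udiff = exact_solution_differentiable_on_elements[OF mesh assms(4,5)]

  \<comment> \<open>Interior edges: the integrands agree almost everywhere up to sign, and each of the two terms
    of the residual is integrable, so its integral may be split.\<close>
  have interior: "of_real (LINT x:edge K i j|arc_length.
        \<alpha> * edge_scale \<kappa> i j * (norm (jump (K i) (K j) v x))\<^sup>2 +
        \<beta> / edge_scale \<kappa> i j * (norm (normal_jump (K i) (K j) (grad v) x))\<^sup>2) =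
      of_real (\<alpha> * edge_scale \<kappa> i j) *
        (LINT x:edge K i j|arc_length.
           (\<Sum>k\<in>UNIV. jump (K i) (K j) err x $ k * cnj (jump (K i) (K j) err x $ k))) +
      of_real (\<beta> / edge_scale \<kappa> i j) *
        (LINT x:edge K i j|arc_length.
           normal_jump (K i) (K j) (grad err) x * cnj (normal_jump (K i) (K j) (grad err) x))"
    (is "of_real ?R = ?G") if ij: "(i, j) \<in> interior_edges N K" for i j
  proof -
    note D = interior_edgesD[OF ij]
    have tr: "AE x in arc_length. x \<in> edge K i j \<longrightarrow> has_side_trace (K k) u x \<and> has_side_trace (K k) (grad u) x"
      if "k \<in> {i, j}" for k
      using assms(6) ij that unfolding has_edge_traces_def by blast
    have ae: "AE x in arc_length. x \<in> edge K i j \<longrightarrow>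
        jump (K i) (K j) err x = - jump (K i) (K j) v x \<and>
        normal_jump (K i) (K j) (grad err) x = - normal_jump (K i) (K j) (grad v) x \<and>
        norm (jump (K i) (K j) v x) = norm (V i x - V j x) \<and>
        normal_jump (K i) (K j) (grad v) x =
          (\<Sum>k\<in>UNIV. (grad (V i) x - grad (V j) x) $ k * of_real (outward_normal (K i) x $ k))"
      using mesh_normals[OF mesh] tr[OF insertI1] tr[OF insertI2[OF singletonI]]
        exact_solution_jumps_vanish[OF assms(1,2,4,5) ij]
    proof eventually_elim
      case (elim x)
      show ?case
      proof
        assume x: "x \<in> edge K i j"
        have t: "has_side_trace (K k) u x \<and> has_side_trace (K k) (grad u) x" if "k \<in> {i, j}" for k
          using that elim(2,3) x by blast
        have s: "side_trace (K i) u x = side_trace (K j) u x" "normal_jump (K i) (K j) (grad u) x = 0"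
          using elim(4) x by blast+
        have ne: "i \<noteq> j" using D by simp
        note e = error_jumps[where u = u and v = v and V = V,
            OF mesh D(1,2) ne udiff V elim(1) x t s]
        show "jump (K i) (K j) err x = - jump (K i) (K j) v x \<and>
          normal_jump (K i) (K j) (grad err) x = - normal_jump (K i) (K j) (grad v) x \<and>
          norm (jump (K i) (K j) v x) = norm (V i x - V j x) \<and>
          normal_jump (K i) (K j) (grad v) x =
            (\<Sum>k\<in>UNIV. (grad (V i) x - grad (V j) x) $ k * of_real (outward_normal (K i) x $ k))"
          unfolding err_def using e by (intro conjI)
      qed
    qed
    have cpt: "compact (edge K i j)"
    proof -
      have "bounded (closure (K i))"
        using assms(1) bounded_subset[OF _ mesh_elements(3)[OF mesh D(1)]]
        unfolding lipschitz_domain_def by (intro bounded_closure) blast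
      then show ?thesis
        by (auto simp: edge_def compact_eq_bounded_closed frontier_def intro: bounded_subset)
    qed
    have "edge K i j \<subseteq> frontier (K i)" by (auto simp: edge_def)
    moreover have "frontier (K i) \<in> sets arc_length"
      using sets_borel_arc_length borel_closed[OF frontier_closed] by blast
    ultimately have "emeasure arc_length (edge K i j) \<le> emeasure arc_length (frontier (K i))"
      by (rule emeasure_mono)
    then have fin: "emeasure arc_length (edge K i j) < \<infinity>"
      using mesh_elements(4)[OF mesh D(1)] by (rule le_less_trans)
    have VC: "continuous_on UNIV (\<lambda>x. (norm (V i x - V j x))\<^sup>2)"
        "continuous_on UNIV (\<lambda>x. grad (V i) x - grad (V j) x)"
    proof -
      have "isCont (V k) x" if "k < N" for k x
        using V(1)[OF that] by (intro differentiable_imp_continuous_within) (simp add: C1_field_def)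
      then have "continuous_on UNIV (V k)" if "k < N" for k
        using that by (simp add: continuous_at_imp_continuous_on)
      then show "continuous_on UNIV (\<lambda>x. (norm (V i x - V j x))\<^sup>2)"
        using D by (intro continuous_on_power continuous_on_norm continuous_on_diff) 
      show "continuous_on UNIV (\<lambda>x. grad (V i) x - grad (V j) x)"
        using V(1) D by (intro continuous_on_diff) (simp_all add: C1_field_def)
    qed
    have int1: "set_integrable arc_length (edge K i j) (\<lambda>x. (norm (jump (K i) (K j) v x))\<^sup>2)"
      using set_integrable_continuous_compact_arc_length[OF cpt fin VC(1)]
      by (rule set_integrable_cong_AE_arc_length) (use ae in eventually_elim, simp)
    have "AE x in arc_length. x \<in> edge K i j \<longrightarrow> is_outward_normal (K i) x (outward_normal (K i) x)"
      using mesh_normals[OF mesh] by eventually_elim (use D in \<open>simp add: edge_def\<close>)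
    from set_integrable_normal_component_square[OF cpt fin VC(2) mesh_elements(2)[OF mesh D(1)] this]
    have int2: "set_integrable arc_length (edge K i j) (\<lambda>x. (norm (normal_jump (K i) (K j) (grad v) x))\<^sup>2)"
      by (rule set_integrable_cong_AE_arc_length) (use ae in eventually_elim, simp)
    have "?R = \<alpha> * edge_scale \<kappa> i j * (LINT x:edge K i j|arc_length. (norm (jump (K i) (K j) v x))\<^sup>2) +
        \<beta> / edge_scale \<kappa> i j * (LINT x:edge K i j|arc_length. (norm (normal_jump (K i) (K j) (grad v) x))\<^sup>2)"
      using int1 int2 by simp
    moreover have "(LINT x:edge K i j|arc_length.
           (\<Sum>k\<in>UNIV. jump (K i) (K j) err x $ k * cnj (jump (K i) (K j) err x $ k))) =
        (LINT x:edge K i j|arc_length. of_real ((norm (jump (K i) (K j) v x))\<^sup>2))"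
      by (rule set_integral_cong_AE_arc_length)
        (use ae in eventually_elim, simp add: sum_mult_cnj_self del: of_real_power)
    moreover have "(LINT x:edge K i j|arc_length.
           normal_jump (K i) (K j) (grad err) x * cnj (normal_jump (K i) (K j) (grad err) x)) =
        (LINT x:edge K i j|arc_length. of_real ((norm (normal_jump (K i) (K j) (grad v) x))\<^sup>2))"
      by (rule set_integral_cong_AE_arc_length)
        (use ae in eventually_elim, auto simp: complex_norm_square simp del: of_real_power)
    ultimately show ?thesis
      by (simp only: set_integral_complex_of_real of_real_add of_real_mult)
  qed

  \<comment> \<open>Dirichlet edges: the trace of the error is \<open>g\<close> minus the trace of \<open>v\<close> almost everywhere.\<close>
  have boundary: "of_real (LINT x:boundary_edge \<Omega> K i|arc_length. (norm (side_trace (K i) v x - g x))\<^sup>2) =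
      (LINT x:boundary_edge \<Omega> K i|arc_length. side_trace (K i) err x * cnj (side_trace (K i) err x))"
    if i: "i < N" for i
  proof -
    have g: "AE x in arc_length. x \<in> boundary_edge \<Omega> K i \<longrightarrow> side_trace (K i) u x = g x"
      using assms(5) i unfolding exact_solution_def by blast
    have t: "AE x in arc_length. x \<in> boundary_edge \<Omega> K i \<longrightarrow> has_side_trace (K i) u x"
      using assms(6) i unfolding has_edge_traces_def by blast
    have "AE x in arc_length. x \<in> boundary_edge \<Omega> K i \<longrightarrow>
        side_trace (K i) err x * cnj (side_trace (K i) err x) =
        of_real ((norm (side_trace (K i) v x - g x))\<^sup>2)"
      using g t mesh_normals[OF mesh]
    proof eventually_elim
      case (elim x)
      show ?case
      proof
        assume x: "x \<in> boundary_edge \<Omega> K i"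
        then have n: "is_outward_normal (K i) x (outward_normal (K i) x)"
          using elim(3) i by (simp add: boundary_edge_def)
        have "has_side_trace (K i) v x"
          using traces_of_C1_extension(1)[OF n mesh_elements(1)[OF mesh i] V(1)[OF i] V(2)[OF i]] .
        then have "side_trace (K i) err x = g x - side_trace (K i) v x"
          using side_trace_diff[OF n, of u v err] elim(1,2) x by (simp add: err_def)
        then show "side_trace (K i) err x * cnj (side_trace (K i) err x) =
            of_real ((norm (side_trace (K i) v x - g x))\<^sup>2)"
          by (simp add: complex_norm_square norm_minus_commute del: of_real_power)
      qed
    qed
    from set_integral_cong_AE_arc_length[OF this] show ?thesis
      by (simp only: set_integral_complex_of_real)
  qed

  have eq: "complex_of_real (residual \<Omega> N K \<kappa> \<alpha> \<beta> xr g c Z) = graph_form \<Omega> N K \<kappa> \<alpha> \<beta> err err"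
    unfolding residual_def Let_def v_def[symmetric] graph_form_def of_real_add of_real_sum
  proof (intro arg_cong2[where f="(+)"] sum.cong refl)
    fix p assume "p \<in> interior_edges N K"
    then show "complex_of_real (case p of (i, j) \<Rightarrow> LINT x:edge K i j|arc_length.
          \<alpha> * edge_scale \<kappa> i j * (norm (jump (K i) (K j) v x))\<^sup>2 +
          \<beta> / edge_scale \<kappa> i j * (norm (normal_jump (K i) (K j) (grad v) x))\<^sup>2) =
        (case p of (i, j) \<Rightarrow> of_real (\<alpha> * edge_scale \<kappa> i j) *
          (LINT x:edge K i j|arc_length.
             (\<Sum>k\<in>UNIV. jump (K i) (K j) err x $ k * cnj (jump (K i) (K j) err x $ k))) +
          of_real (\<beta> / edge_scale \<kappa> i j) *
          (LINT x:edge K i j|arc_length.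
             normal_jump (K i) (K j) (grad err) x * cnj (normal_jump (K i) (K j) (grad err) x)))"
      using interior by (cases p) (simp only: prod.case)
  next
    fix i assume "i \<in> {..<N}"
    then show "complex_of_real (\<alpha> * \<kappa> i *
          (LINT x:boundary_edge \<Omega> K i|arc_length. (norm (side_trace (K i) v x - g x))\<^sup>2)) =
        of_real (\<alpha> * \<kappa> i) *
          (LINT x:boundary_edge \<Omega> K i|arc_length. side_trace (K i) err x * cnj (side_trace (K i) err x))"
      using boundary[of i] by (simp only: of_real_mult lessThan_iff)
  qed

  have "0 \<le> residual \<Omega> N K \<kappa> \<alpha> \<beta> xr g c Z"
    unfolding residual_def Let_def
  proof (intro add_nonneg_nonneg sum_nonneg)
    fix p assume p: "p \<in> interior_edges N K"
    obtain i j where ij: "p = (i, j)" by (cases p)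
    with p have "0 \<le> edge_scale \<kappa> i j"
      using \<kappa>[of i] \<kappa>[of j] interior_edgesD[of i j N K] by (simp add: edge_scale_def)
    then show "0 \<le> (case p of (i, j) \<Rightarrow> LINT x:edge K i j|arc_length.
          \<alpha> * edge_scale \<kappa> i j * (norm (jump (K i) (K j) (trefftz_field N K \<kappa> xr c Z) x))\<^sup>2 +
          \<beta> / edge_scale \<kappa> i j * (norm (normal_jump (K i) (K j) (grad (trefftz_field N K \<kappa> xr c Z)) x))\<^sup>2)"
      using \<open>0 < \<alpha>\<close> \<open>0 < \<beta>\<close> unfolding ij prod.case set_lebesgue_integral_def
      by (intro integral_nonneg_AE AE_I2 scaleR_nonneg_nonneg add_nonneg_nonneg mult_nonneg_nonneg divide_nonneg_nonneg) auto
  next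
    fix i assume "i \<in> {..<N}"
    then show "0 \<le> \<alpha> * \<kappa> i * (LINT x:boundary_edge \<Omega> K i|arc_length.
        (norm (side_trace (K i) (trefftz_field N K \<kappa> xr c Z) x - g x))\<^sup>2)"
      using \<open>0 < \<alpha>\<close> \<kappa>[of i] unfolding set_lebesgue_integral_def
      by (intro mult_nonneg_nonneg integral_nonneg_AE AE_I2 scaleR_nonneg_nonneg) auto
  qed
  then have "graph_form \<Omega> N K \<kappa> \<alpha> \<beta> err err = complex_of_real ((graph_norm \<Omega> N K \<kappa> \<alpha> \<beta> err)\<^sup>2)"
    unfolding graph_norm_def eq[symmetric] by simp
  moreover have "err = (\<lambda>x. u x - trefftz_field N K \<kappa> xr c Z x)"
    by (simp add: fun_eq_iff err_def v_def)
  ultimately show ?thesis using eq unfolding Let_def by simp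
qed

end
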